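(* Let $p,q>0$ and $a\in\mathbb{R}$, let $(W_t)_{t\ge 0}$, $(W^{(1)}_t)_{t\ge 0}$, $(W^{(2)}_t)_{t\ge 0}$ be three independent standard one-dimensional Brownian motions (started at $0$), and let $\mathfrak Z_t=(X_t,Y_t,Z_t)$, $t\ge0$, be the Brownian motion with drift on $\mathrm{Sol}(p,q)$ given by $$Z_t = a\,t + W_t,\qquad X_t=\int_0^t e^{pZ_s}\,dW^{(1)}_s,\qquad Y_t=\int_0^t e^{-qZ_s}\,dW^{(2)}_s .$$ Let $\mathfrak o=(0,0,0)$. Then, for any value of $a$, $$\lim_{t\to\infty}\frac{d_{\mathrm{Sol}}(\mathfrak Z_t,\mathfrak o)}{t}=|a|\quad\text{almost surely.}$$
   Context: $\mathrm{Sol}(p,q)$ is $\mathbb{R}^3$ with coordinates $(x,y,z)$ and the Riemannian metric $ds^2=e^{-2pz}\,dx^2+e^{2qz}\,dy^2+dz^2$; $d_{\mathrm{Sol}}$ denotes the induced Riemannian distance. The integrals are Itô stochastic integrals (continuous versions); $(\mathfrak Z_t)$ is the continuous diffusion started at $\mathfrak o$ with infinitesimal generator $\frac12\bigl(e^{2pz}\partial_x^2+e^{-2qz}\partial_y^2+\partial_z^2\bigr)+a\,\partial_z$. *)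

theory Defs
  imports "HOL-Probability.Probability"
begin

section \<open>The Riemannian manifold Sol(p,q)\<close>

text \<open>Points and tangent vectors are both triples.\<close>

definition sol_metric ::
  "real \<Rightarrow> real \<Rightarrow> real \<times> real \<times> real \<Rightarrow> real \<times> real \<times> real \<Rightarrow> real \<times> real \<times> real \<Rightarrow> real"
where
  "sol_metric p q P U V =
     (case (P, U, V) of ((x, y, z), (u1, u2, u3), (v1, v2, v3)) \<Rightarrow>
       exp (- 2 * p * z) * (u1 * v1) + exp (2 * q * z) * (u2 * v2) + u3 * v3)"

definition sol_norm :: "real \<Rightarrow> real \<Rightarrow> real \<times> real \<times> real \<Rightarrow> real \<times> real \<times> real \<Rightarrow> real" where
  "sol_norm p q P U = sqrt (sol_metric p q P U U)"

text \<open>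
  The length is stated with \<open>has_integral\<close>, not with \<open>integral\<close>: a \<open>valid_path\<close> may have an
  unbounded derivative near its finitely many exceptional points and hence infinite length, and
  the default value \<open>0\<close> of \<open>integral\<close> must not enter the infimum below.
\<close>

definition sol_has_length :: "real \<Rightarrow> real \<Rightarrow> (real \<Rightarrow> real \<times> real \<times> real) \<Rightarrow> real \<Rightarrow> bool" where
  "sol_has_length p q \<gamma> l \<longleftrightarrow>
     ((\<lambda>t. sol_norm p q (\<gamma> t) (vector_derivative \<gamma> (at t))) has_integral l) {0..1}"

definition sol_dist :: "real \<Rightarrow> real \<Rightarrow> real \<times> real \<times> real \<Rightarrow> real \<times> real \<times> real \<Rightarrow> real" where
  "sol_dist p q P Q =
     Inf {l. \<exists>\<gamma>. valid_path \<gamma> \<and> pathstart \<gamma> = P \<and> pathfinish \<gamma> = Q \<and> sol_has_length p q \<gamma> l}"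


section \<open>Brownian motion\<close>

text \<open>
  Processes are indexed by all reals, but only the values at times \<open>t \<ge> 0\<close> are constrained or used.
  As usual for a continuous process, every path is continuous.
\<close>

locale brownian_motion = prob_space M for M :: "'a measure" +
  fixes B :: "real \<Rightarrow> 'a \<Rightarrow> real"
  assumes measurable_at: "\<And>t. 0 \<le> t \<Longrightarrow> random_variable borel (B t)"
    and starts_at_0: "AE \<omega> in M. B 0 \<omega> = 0"
    and continuous_paths: "\<And>\<omega>. \<omega> \<in> space M \<Longrightarrow> continuous_on {0..} (\<lambda>t. B t \<omega>)"
    and normal_increments: "\<And>s t. 0 \<le> s \<Longrightarrow> s < t \<Longrightarrow>
          distributed M lborel (\<lambda>\<omega>. B t \<omega> - B s \<omega>) (normal_density 0 (sqrt (t - s)))"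
    and indep_increments: "\<And>(\<tau> :: nat \<Rightarrow> real) n. 0 \<le> \<tau> 0 \<Longrightarrow> (\<And>i. i < n \<Longrightarrow> \<tau> i \<le> \<tau> (Suc i)) \<Longrightarrow>
          indep_vars (\<lambda>_. borel) (\<lambda>i \<omega>. B (\<tau> (Suc i)) \<omega> - B (\<tau> i) \<omega>) {..<n}"

text \<open>Mutual independence of whole processes, as random elements of the product space over time.\<close>

definition (in prob_space) indep_processes :: "(real \<Rightarrow> 'a \<Rightarrow> real) list \<Rightarrow> bool" where
  "indep_processes Bs \<longleftrightarrow>
     indep_vars (\<lambda>_. Pi\<^sub>M {0..} (\<lambda>_. borel)) (\<lambda>i \<omega>. \<lambda>t\<in>{0..}. (Bs ! i) t \<omega>) {..<length Bs}"

definition natural_filtration :: "'a measure \<Rightarrow> (real \<Rightarrow> 'a \<Rightarrow> real) list \<Rightarrow> real \<Rightarrow> 'a measure" where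
  "natural_filtration M Bs t =
     sigma (space M) {B s -` A \<inter> space M | B s A. B \<in> set Bs \<and> 0 \<le> s \<and> s \<le> t \<and> A \<in> sets borel}"


section \<open>The Ito integral\<close>

definition progressively_measurable ::
  "(real \<Rightarrow> 'a measure) \<Rightarrow> (real \<Rightarrow> 'a \<Rightarrow> real) \<Rightarrow> bool"
where
  "progressively_measurable F H \<longleftrightarrow>
     (\<forall>T\<ge>0. (\<lambda>(s, \<omega>). H s \<omega>) \<in> borel_measurable (restrict_space borel {0..T} \<Otimes>\<^sub>M F T))"

text \<open>
  \<open>(n, \<tau>, \<xi>)\<close> encodes the simple process that equals \<open>\<xi> i\<close> on the time interval
  \<open>(\<tau> i, \<tau> (i + 1)]\<close> for \<open>i < n\<close>, and \<open>0\<close> elsewhere.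
\<close>

type_synonym 'a simple_process = "nat \<times> (nat \<Rightarrow> real) \<times> (nat \<Rightarrow> 'a \<Rightarrow> real)"

definition is_simple_process :: "'a measure \<Rightarrow> (real \<Rightarrow> 'a measure) \<Rightarrow> 'a simple_process \<Rightarrow> bool" where
  "is_simple_process M F S \<longleftrightarrow> (case S of (n, \<tau>, \<xi>) \<Rightarrow>
     0 \<le> \<tau> 0 \<and>
     (\<forall>i<n. \<tau> i < \<tau> (Suc i) \<and> \<xi> i \<in> borel_measurable (F (\<tau> i)) \<and> bounded (\<xi> i ` space M)))"

definition simple_value :: "'a simple_process \<Rightarrow> real \<Rightarrow> 'a \<Rightarrow> real" where
  "simple_value S t \<omega> = (case S of (n, \<tau>, \<xi>) \<Rightarrow>
     \<Sum>i<n. \<xi> i \<omega> * indicator {\<tau> i<..\<tau> (Suc i)} t)"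

definition simple_integral_wrt :: "(real \<Rightarrow> 'a \<Rightarrow> real) \<Rightarrow> 'a simple_process \<Rightarrow> real \<Rightarrow> 'a \<Rightarrow> real" where
  "simple_integral_wrt B S t \<omega> = (case S of (n, \<tau>, \<xi>) \<Rightarrow>
     \<Sum>i<n. \<xi> i \<omega> * (B (min t (\<tau> (Suc i))) \<omega> - B (min t (\<tau> i)) \<omega>))"

text \<open>
  Measurability is part of the definition because \<open>emeasure\<close> is \<open>0\<close> on non-measurable sets.
\<close>

definition null_in_probability :: "'a measure \<Rightarrow> (nat \<Rightarrow> 'a \<Rightarrow> ennreal) \<Rightarrow> bool" where
  "null_in_probability M D \<longleftrightarrow>
     (\<forall>k. D k \<in> borel_measurable M) \<and>
     (\<forall>\<epsilon>>0. (\<lambda>k. emeasure M {\<omega> \<in> space M. \<epsilon> \<le> D k \<omega>}) \<longlonglongrightarrow> 0)"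

text \<open>
  \<open>I\<close> is a continuous version of the process \<open>t \<mapsto> \<integral>\<^sub>0\<^sup>t H\<^sub>s dB\<^sub>s\<close>: \<open>H\<close> is
  progressively measurable and almost surely locally square integrable in time, and the integrals
  of simple processes approximating \<open>H\<close> converge in probability to \<open>I\<close>. When \<open>B\<close> is a Brownian motion
  with respect to the filtration \<open>F\<close>, the limit does not depend on the approximating sequence, so
  \<open>I\<close> is unique up to indistinguishability. This is the case for each of finitely many independent
  Brownian motions and their joint natural filtration. \<open>I\<close> is a version in the almost sure sense, so
  it is not required to be adapted to \<open>F\<close>, which is not assumed to be complete.
\<close>

definition has_ito_integral ::
  "'a measure \<Rightarrow> (real \<Rightarrow> 'a measure) \<Rightarrow> (real \<Rightarrow> 'a \<Rightarrow> real) \<Rightarrow> (real \<Rightarrow> 'a \<Rightarrow> real) \<Rightarrow>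
   (real \<Rightarrow> 'a \<Rightarrow> real) \<Rightarrow> bool"
where
  "has_ito_integral M F B H I \<longleftrightarrow>
     progressively_measurable F H \<and>
     (\<forall>T\<ge>0. AE \<omega> in M. (\<integral>\<^sup>+ s\<in>{0..T}. ennreal ((H s \<omega>)\<^sup>2) \<partial>lborel) < \<infinity>) \<and>
     (\<forall>t\<ge>0. I t \<in> borel_measurable M) \<and>
     (AE \<omega> in M. continuous_on {0..} (\<lambda>t. I t \<omega>)) \<and>
     (\<exists>S :: nat \<Rightarrow> 'a simple_process.
        (\<forall>k. is_simple_process M F (S k)) \<and>
        (\<forall>T\<ge>0. null_in_probability M
           (\<lambda>k \<omega>. \<integral>\<^sup>+ s\<in>{0..T}. ennreal ((simple_value (S k) s \<omega> - H s \<omega>)\<^sup>2) \<partial>lborel)) \<and>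
        (\<forall>t\<ge>0. null_in_probability M
           (\<lambda>k \<omega>. ennreal \<bar>simple_integral_wrt B (S k) t \<omega> - I t \<omega>\<bar>)))"

end

theory Submission
  imports Defs
begin

text \<open>
  The distance of \<open>(x, y, z)\<close> from the origin is at least the height difference \<open>\<bar>z\<bar>\<close>, because the
  vertical component of a velocity never exceeds its norm (\<open>height_le_sol_dist_origin\<close>). In the
  other direction a horizontal displacement by \<open>x\<close> is cheap far up and one by \<open>y\<close> is cheap far
  down: at height \<open>z\<close> they cost \<open>exp (- p * z) * \<bar>x\<bar>\<close> and \<open>exp (q * z) * \<bar>y\<bar>\<close>. Suppose that, up to an
  error \<open>\<epsilon> * t\<close> in the height and in the exponents, \<open>z = a * t\<close>, \<open>\<bar>x\<bar> \<le> exp (p * max a 0 * t)\<close> and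
  \<open>\<bar>y\<bar> \<le> exp (q * max (- a) 0 * t)\<close>. Then the levels \<open>(max a 0 + \<epsilon>) * t\<close> and
  \<open>- (max (- a) 0 + \<epsilon>) * t\<close> make both horizontal pieces of length at most \<open>1\<close>. A path that visits
  both levels, going first to the one close to its starting height, has length
  \<open>\<bar>a\<bar> * t + O(\<epsilon> * t) + O(1)\<close> (\<open>sol_dist_le_of_growth_bounds\<close>). It remains to prove these three bounds
  almost surely, for every \<open>\<epsilon>\<close> and all large \<open>t\<close>.

  All three follow from one maximal inequality for the Ito integral \<open>I\<close> of a process \<open>H\<close>: the event
  that \<open>\<bar>I\<bar>\<close> exceeds \<open>r\<close> somewhere on \<open>{0..T}\<close> while \<open>H\<^sup>2\<close> has integral less than \<open>\<delta>\<close> over \<open>{0..T}\<close> has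
  probability at most \<open>16 * \<delta> / r\<^sup>2\<close> (\<open>ito_maximal_inequality\<close>). For simple \<open>H\<close> this is an inequality
  for discrete martingale transforms (\<open>martingale_transform_maximal_inequality\<close>). The event survives
  the approximation of \<open>H\<close> by simple processes because it only involves quantities that
  converge in probability. The discrete inequality rests on the
  independence of a Brownian increment from the joint past of all the given processes
  (\<open>independent_past_and_increment\<close>). By the Borel--Cantelli lemma the inequality eventually bounds
  \<open>\<bar>I\<bar>\<close> by \<open>r\<close> along a sequence of such \<open>T\<close>, \<open>r\<close>, \<open>\<delta>\<close> if \<open>\<delta> / r\<^sup>2\<close> is summable and the integrals of \<open>H\<^sup>2\<close>
  are eventually below \<open>\<delta>\<close> (\<open>ito_eventually_bounded\<close>).

  With \<open>H = 1\<close> and dyadic times this yields the law of large numbers for Brownian motion, hence the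
  bound on \<open>z\<close>. That bound in turn says that the integrands \<open>exp (p * Z)\<close> and \<open>exp (- q * Z)\<close> grow at
  most at the exponential rates \<open>p * max a 0\<close> and \<open>q * max (- a) 0\<close>, and an Ito integral inherits the
  nonnegative exponential rate of its integrand (\<open>ito_exponential_growth\<close>).
\<close>

section \<open>Distances in Sol(p,q)\<close>

text \<open>
  The distance is the infimum of the \<open>l\<close> in this relation. Unlike the distance itself, the relation
  can be composed along concatenated paths without knowing that any infimum is attained.
\<close>
definition sol_connected :: "real \<Rightarrow> real \<Rightarrow> real \<times> real \<times> real \<Rightarrow> real \<times> real \<times> real \<Rightarrow> real \<Rightarrow> bool" where
  "sol_connected p q P Q l \<longleftrightarrow>
     (\<exists>\<gamma>. valid_path \<gamma> \<and> pathstart \<gamma> = P \<and> pathfinish \<gamma> = Q \<and> sol_has_length p q \<gamma> l)"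

lemma abs_height_le_sol_norm: "\<bar>snd (snd U)\<bar> \<le> sol_norm p q P U"
proof -
  obtain x y z u1 u2 u3 where [simp]: "P = (x, y, z)" "U = (u1, u2, u3)" by (metis prod_cases3)
  have "u3 * u3 \<le> sol_metric p q P U U" by (simp add: sol_metric_def)
  then have "sqrt (u3 * u3) \<le> sol_norm p q P U" unfolding sol_norm_def by (rule real_sqrt_le_mono)
  then show ?thesis by simp
qed

text \<open>
  The velocity dominates its vertical component pointwise, so the length dominates the integral of
  the vertical component, which is the height difference by the fundamental theorem of calculus.
\<close>
lemma sol_connected_height_le:
  assumes "sol_connected p q P Q l"
  shows "\<bar>snd (snd P) - snd (snd Q)\<bar> \<le> l"
proof -
  from assms obtain \<gamma> where \<gamma>: "valid_path \<gamma>" "pathstart \<gamma> = P" "pathfinish \<gamma> = Q"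
    "sol_has_length p q \<gamma> l" by (auto simp: sol_connected_def)
  from \<gamma>(1) obtain K where K: "finite K" "\<forall>x\<in>{0..1} - K. \<gamma> differentiable at x" "continuous_on {0..1} \<gamma>"
    by (auto simp: valid_path_def piecewise_C1_differentiable_on_def C1_differentiable_on_eq)
  let ?h = "\<lambda>t. snd (snd (\<gamma> t))"
  let ?h' = "\<lambda>t. snd (snd (vector_derivative \<gamma> (at t)))"
  have bl: "bounded_linear (\<lambda>U :: real \<times> real \<times> real. snd (snd U))"
    by (intro bounded_linear_compose[OF bounded_linear_snd] bounded_linear_snd)
  have "(?h' has_integral (?h 1 - ?h 0)) {0..1}"
  proof (rule fundamental_theorem_of_calculus_interior_strong[OF K(1)])
    show "continuous_on {0..1} ?h" using K(3) by (intro continuous_intros)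
    fix t :: real assume "t \<in> {0<..<1} - K"
    then have "(\<gamma> has_vector_derivative vector_derivative \<gamma> (at t)) (at t)"
      using K(2) by (auto simp: vector_derivative_works)
    then show "(?h has_vector_derivative ?h' t) (at t)"
      by (rule bounded_linear.has_vector_derivative[OF bl])
  qed simp
  then have h: "(?h' has_integral (snd (snd Q) - snd (snd P))) {0..1}"
    using \<gamma> by (simp add: pathstart_def pathfinish_def)
  have len: "((\<lambda>t. sol_norm p q (\<gamma> t) (vector_derivative \<gamma> (at t))) has_integral l) {0..1}"
    using \<gamma>(4) by (simp add: sol_has_length_def)
  have "snd (snd Q) - snd (snd P) \<le> l"
    by (rule has_integral_le[OF h len]) (use abs_height_le_sol_norm abs_le_D1 in blast)
  moreover have "- (snd (snd Q) - snd (snd P)) \<le> l"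
    by (rule has_integral_le[OF has_integral_neg[OF h] len])
        (use abs_height_le_sol_norm abs_le_D2 in blast)
  ultimately show ?thesis by linarith
qed

lemma sol_dist_le: "sol_connected p q P Q l \<Longrightarrow> sol_dist p q P Q \<le> l"
  unfolding sol_dist_def sol_connected_def[symmetric]
  by (rule cInf_lower) (auto intro!: bdd_belowI[of _ "\<bar>snd (snd P) - snd (snd Q)\<bar>"] sol_connected_height_le)

text \<open>
  The existence of one path enters because \<open>Inf {}\<close> has no useful value.
\<close>
lemma height_le_sol_dist:
  "sol_connected p q P Q l \<Longrightarrow> \<bar>snd (snd P) - snd (snd Q)\<bar> \<le> sol_dist p q P Q"
  unfolding sol_dist_def sol_connected_def[symmetric]
  by (rule cInf_greatest) (auto intro!: sol_connected_height_le)

lemma sol_norm_scaleR: "0 \<le> c \<Longrightarrow> sol_norm p q P (c *\<^sub>R U) = c * sol_norm p q P U"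
proof -
  assume "0 \<le> c"
  have "sol_metric p q P (c *\<^sub>R U) (c *\<^sub>R U) = c\<^sup>2 * sol_metric p q P U U"
    by (cases P; cases U) (simp add: sol_metric_def power2_eq_square algebra_simps)
  then show ?thesis using \<open>0 \<le> c\<close> by (simp add: sol_norm_def real_sqrt_mult)
qed

lemma vector_derivative_locally_affine:
  assumes "g differentiable at (m * x + c)" and "open A" "x \<in> A" "\<And>y. y \<in> A \<Longrightarrow> g (m * y + c) = h y"
  shows "vector_derivative h (at x) = m *\<^sub>R vector_derivative g (at (m * x + c))"
proof (rule vector_derivative_at)
  have "((\<lambda>y. m * y + c) has_vector_derivative m) (at x)"
    by (auto intro!: derivative_eq_intros)
  then have "(g \<circ> (\<lambda>y. m * y + c) has_vector_derivative m *\<^sub>R vector_derivative g (at (m * x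
      + c))) (at x)"
    using assms(1) by (intro vector_diff_chain_at) (simp_all add: vector_derivative_works)
  then show "(h has_vector_derivative m *\<^sub>R vector_derivative g (at (m * x + c))) (at x)"
    by (rule has_vector_derivative_transform_within_open[OF _ assms(2,3)]) (simp add: assms(4))
qed

text \<open>
  The doubled velocity makes up for the halved parameter interval, since the norm is homogeneous. The
  cases \<open>d = 0\<close> and \<open>d = 1\<close> are the two halves of a joined path.
\<close>
lemma length_at_double_speed:
  assumes g: "valid_path g" "sol_has_length p q g l"
    and h: "\<And>y. y \<in> {d / 2<..<(d + 1) / 2} \<Longrightarrow> g (2 * y + - d) = h y"
  shows "((\<lambda>t. sol_norm p q (h t) (vector_derivative h (at t))) has_integral l) {d / 2..(d
      + 1) / 2}"
proof -
  obtain K where K: "finite K" "\<forall>x\<in>{0..1} - K. g differentiable at x"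
    using g(1) by (auto simp: valid_path_def piecewise_C1_differentiable_on_def C1_differentiable_on_eq)
  let ?n = "\<lambda>t. sol_norm p q (g t) (vector_derivative g (at t))"
  let ?K = "{d / 2, (d + 1) / 2} \<union> (\<lambda>x. 2 * x + - d) -` K"
  have "((\<lambda>x. ?n (2 * x + - d)) has_integral (1 / \<bar>2\<bar>) *\<^sub>R l) ((\<lambda>x. x / 2 - (- d) / 2) ` {0..1})"
    using g(2) unfolding sol_has_length_def by (rule has_integral_affinity01) simp
  then have "((\<lambda>x. ?n (2 * x + - d)) has_integral l / 2) {d / 2..(d + 1) / 2}"
    unfolding image_affinity_atLeastAtMost_div_diff by (simp add: add_divide_distrib add.commute)
  from has_integral_mult_right[OF this, of 2]
  have int: "((\<lambda>x. 2 * ?n (2 * x + - d)) has_integral l) {d / 2..(d + 1) / 2}" by simp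
  show ?thesis
  proof (rule has_integral_spike_finite[OF _ _ int])
    show "finite ?K"
      using K(1) by (intro finite_UnI finite_vimageI) (auto simp: inj_on_def)
    fix x assume x: "x \<in> {d / 2..(d + 1) / 2} - ?K"
    then have x': "x \<in> {d / 2<..<(d + 1) / 2}" "2 * x + - d \<in> {0..1} - K" by auto
    have "vector_derivative h (at x) = 2 *\<^sub>R vector_derivative g (at (2 * x + - d))"
      by (rule vector_derivative_locally_affine[where A="{d / 2<..<(d + 1) / 2}"])
        (use x' K(2) h in auto)
    then show "sol_norm p q (h x) (vector_derivative h (at x)) = 2 * ?n (2 * x + - d)"
      by (simp add: sol_norm_scaleR h[OF x'(1), symmetric])
  qed
qed

lemma sol_has_length_join:
  assumes "sol_has_length p q g1 l1" "sol_has_length p q g2 l2" "valid_path g1" "valid_path g2"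
  shows "sol_has_length p q (g1 +++ g2) (l1 + l2)"
proof -
  let ?n = "\<lambda>t. sol_norm p q ((g1 +++ g2) t) (vector_derivative (g1 +++ g2) (at t))"
  have "(?n has_integral l1) {0..1 / 2}"
    using length_at_double_speed[OF assms(3,1), of 0 "g1 +++ g2"] by (simp add: joinpaths_def)
  moreover have "(?n has_integral l2) {1 / 2..1}"
    using length_at_double_speed[OF assms(4,2), of 1 "g1 +++ g2"] by (simp add: joinpaths_def)
  ultimately show ?thesis
    unfolding sol_has_length_def by (rule has_integral_combine[rotated 2]) auto
qed

lemma sol_connected_trans:
  "sol_connected p q P Q l1 \<Longrightarrow> sol_connected p q Q R l2 \<Longrightarrow> sol_connected p q P R (l1 + l2)"
  unfolding sol_connected_def
  by (metis (no_types, lifting) sol_has_length_join valid_path_join pathstart_join pathfinish_join)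

lemma sol_connected_linepath:
  assumes "\<And>t. t \<in> {0..1} \<Longrightarrow> sol_norm p q (linepath P Q t) (Q - P) = l"
  shows "sol_connected p q P Q l"
proof -
  have "((\<lambda>t. sol_norm p q (linepath P Q t) (vector_derivative (linepath P Q) (at t))) has_integral l) {0..1}"
    using has_integral_const_real[of l 0 1] assms
    by (subst has_integral_cong[of _ _ "\<lambda>_. l"]) (auto simp: vector_derivative_linepath_at)
  then show ?thesis unfolding sol_connected_def sol_has_length_def
    by (intro exI[of _ "linepath P Q"]) auto
qed

lemma sol_connected_vertical: "sol_connected p q (x, y, z) (x, y, z') \<bar>z - z'\<bar>"
  by (rule sol_connected_linepath)
      (auto simp: sol_norm_def sol_metric_def power2_eq_square[symmetric])

lemma sol_connected_x: "sol_connected p q (x, y, z) (0, y, z) (exp (- p * z) * \<bar>x\<bar>)"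
proof (rule sol_connected_linepath)
  have "sqrt (exp (- 2 * p * z) * (x * x)) = exp (- p * z) * \<bar>x\<bar>"
    by (rule real_sqrt_unique) (auto simp: power2_eq_square exp_add[symmetric] mult_ac)
  then show "sol_norm p q (linepath (x, y, z) (0, y, z) t) ((0, y, z) - (x, y, z))
      = exp (- p * z) * \<bar>x\<bar>"
    if "t \<in> {0..1}" for t
    by (simp add: sol_norm_def sol_metric_def linepath_def zero_prod_def algebra_simps)
qed

lemma sol_connected_y: "sol_connected p q (x, y, z) (x, 0, z) (exp (q * z) * \<bar>y\<bar>)"
proof (rule sol_connected_linepath)
  have "sqrt (exp (2 * q * z) * (y * y)) = exp (q * z) * \<bar>y\<bar>"
    by (rule real_sqrt_unique) (auto simp: power2_eq_square exp_add[symmetric] mult_ac)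
  then show "sol_norm p q (linepath (x, y, z) (x, 0, z) t) ((x, 0, z) - (x, y, z))
      = exp (q * z) * \<bar>y\<bar>"
    if "t \<in> {0..1}" for t
    by (simp add: sol_norm_def sol_metric_def linepath_def zero_prod_def algebra_simps)
qed

lemma height_le_sol_dist_origin: "\<bar>z\<bar> \<le> sol_dist p q (x, y, z) (0, 0, 0)"
  using height_le_sol_dist[OF sol_connected_trans[OF sol_connected_x[of p q x y z]
      sol_connected_trans[OF sol_connected_y sol_connected_vertical[of _ _ _ _ _ 0]]]] by simp

text \<open>
  Rise or descend to the level \<open>U\<close>, remove \<open>x\<close> there, go to the level \<open>L\<close>, remove \<open>y\<close> there, and
  return to height \<open>0\<close>.
\<close>
lemma sol_dist_le_via_upper_level:
  "sol_dist p q (x, y, z) (0, 0, 0) \<le>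
     \<bar>z - U\<bar> + exp (- p * U) * \<bar>x\<bar> + \<bar>U - L\<bar> + exp (q * L) * \<bar>y\<bar> + \<bar>L\<bar>"
proof -
  note sol_connected_trans[OF sol_connected_vertical[of p q x y z U] sol_connected_trans[OF sol_connected_x
      sol_connected_trans[OF sol_connected_vertical[of _ _ _ _ U L] sol_connected_trans[OF sol_connected_y
      sol_connected_vertical[of _ _ _ _ L 0]]]]]
  from sol_dist_le[OF this] show ?thesis by (simp add: algebra_simps)
qed

text \<open>
  The mirror image of the preceding path. Which of the two is short depends on whether \<open>z\<close> is closer
  to \<open>U\<close> or to \<open>L\<close>: starting with the far level would add a multiple of \<open>\<bar>z\<bar>\<close>.
\<close>
lemma sol_dist_le_via_lower_level:
  "sol_dist p q (x, y, z) (0, 0, 0) \<le>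
     \<bar>z - L\<bar> + exp (q * L) * \<bar>y\<bar> + \<bar>L - U\<bar> + exp (- p * U) * \<bar>x\<bar> + \<bar>U\<bar>"
proof -
  note sol_connected_trans[OF sol_connected_vertical[of p q x y z L] sol_connected_trans[OF sol_connected_y
      sol_connected_trans[OF sol_connected_vertical[of _ _ _ _ L U] sol_connected_trans[OF sol_connected_x
      sol_connected_vertical[of _ _ _ _ U 0]]]]]
  from sol_dist_le[OF this] show ?thesis by (simp add: algebra_simps)
qed

text \<open>
  The chosen levels exactly cancel the exponential bounds, so each horizontal piece has length at
  most \<open>1\<close>. The vertical pieces have total length at most \<open>\<bar>a\<bar> * t + 5 * \<epsilon> * t\<close>.
\<close>
lemma sol_dist_le_of_growth_bounds:
  assumes "0 < \<epsilon>" "0 \<le> t" "\<bar>z - a * t\<bar> \<le> \<epsilon> * t"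
    and x: "\<bar>x\<bar> \<le> exp ((p * max a 0 + p * \<epsilon>) * t)"
    and y: "\<bar>y\<bar> \<le> exp ((q * max (- a) 0 + q * \<epsilon>) * t)"
  shows "sol_dist p q (x, y, z) (0, 0, 0) \<le> \<bar>a\<bar> * t + 5 * \<epsilon> * t + 2"
proof -
  define U where "U = (max a 0 + \<epsilon>) * t"
  define L where "L = - (max (- a) 0 + \<epsilon>) * t"
  have x1: "exp (- p * U) * \<bar>x\<bar> \<le> 1"
  proof -
    have "exp (- p * U) * \<bar>x\<bar> \<le> exp (- p * U) * exp ((p * max a 0 + p * \<epsilon>) * t)"
      using x by (intro mult_left_mono) auto
    also have "\<dots> = 1" by (simp add: exp_add[symmetric] U_def algebra_simps)
    finally show ?thesis .
  qed
  have y1: "exp (q * L) * \<bar>y\<bar> \<le> 1"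
  proof -
    have "exp (q * L) * \<bar>y\<bar> \<le> exp (q * L) * exp ((q * max (- a) 0 + q * \<epsilon>) * t)"
      using y by (intro mult_left_mono) auto
    also have "\<dots> = 1" by (simp add: exp_add[symmetric] L_def algebra_simps)
    finally show ?thesis .
  qed
  have \<epsilon>t: "0 \<le> \<epsilon> * t" using assms by simp
  show ?thesis
  proof (cases "0 \<le> a")
    case True
    then have at: "0 \<le> a * t" and U: "U = a * t + \<epsilon> * t" and L: "L = - (\<epsilon> * t)" and "\<bar>a\<bar> * t
        = a * t"
      using assms(2) by (auto simp: U_def L_def algebra_simps)
    then show ?thesis
      using sol_dist_le_via_upper_level[of p q x y z U L] x1 y1 assms(3) \<epsilon>t by linarith
  next
    case False
    then have at: "a * t \<le> 0" and U: "U = \<epsilon> * t" and L: "L = a * t - (\<epsilon> * t)" and "\<bar>a\<bar> * t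
        = - (a * t)"
      using assms(2) by (auto simp: U_def L_def algebra_simps mult_nonpos_nonneg)
    then show ?thesis
      using sol_dist_le_via_lower_level[of p q x y z L U] x1 y1 assms(3) \<epsilon>t by linarith
  qed
qed

section \<open>A maximal inequality for martingale transforms\<close>

text \<open>
  The last nonzero summand is present only if the full sum up to it is at most \<open>\<delta>\<close>. The predicate
  \<open>P\<close> leaves room for a second reason to drop a summand.
\<close>
lemma truncated_sum_le:
  fixes c :: "nat \<Rightarrow> real"
  assumes "0 \<le> \<delta>" "\<And>j. 0 \<le> c j"
  shows "(\<Sum>l<m. if (\<Sum>i<Suc l. c i) \<le> \<delta> \<and> P l then c l else 0) \<le> \<delta>"
proof -
  have le: "(\<Sum>l<m. if (\<Sum>i<Suc l. c i) \<le> \<delta> \<and> P l then c l else 0) \<le> (\<Sum>i<m. c i)" for m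
    by (intro sum_mono) (use assms in auto)
  show ?thesis
  proof (induction m)
    case (Suc m)
    show ?case
    proof (cases "(\<Sum>i<Suc m. c i) \<le> \<delta> \<and> P m")
      case True
      then show ?thesis using le[of "Suc m"] by linarith
    qed (use Suc in auto)
  qed (use assms in simp)
qed

context prob_space
begin

text \<open>
  In the expansion of the square the mixed term with the newest increment has expectation zero, since
  that increment is centred and independent of everything before it. The partial sums are
  unbounded, so their integrability is carried along in the induction.
\<close>
lemma orthogonal_sum_second_moment:
  fixes G :: "nat \<Rightarrow> 'a measure" and \<theta> D :: "nat \<Rightarrow> 'a \<Rightarrow> real" and v :: "nat \<Rightarrow> real"
  assumes sub: "\<And>j. subalgebra M (G j)"
    and mono: "\<And>j. subalgebra (G (Suc j)) (G j)"
    and D_adapted: "\<And>j. j < m \<Longrightarrow> D j \<in> borel_measurable (G (Suc j))"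
    and D_indep: "\<And>j g. j < m \<Longrightarrow> g \<in> borel_measurable (G j) \<Longrightarrow> indep_var borel g borel (D j)"
    and D_int: "\<And>j. j < m \<Longrightarrow> integrable M (D j)"
    and D_mean: "\<And>j. j < m \<Longrightarrow> expectation (D j) = 0"
    and D2_int: "\<And>j. j < m \<Longrightarrow> integrable M (\<lambda>\<omega>. (D j \<omega>)\<^sup>2)"
    and D2_mean: "\<And>j. j < m \<Longrightarrow> expectation (\<lambda>\<omega>. (D j \<omega>)\<^sup>2) = v j"
    and \<theta>_adapted: "\<And>j. j < m \<Longrightarrow> \<theta> j \<in> borel_measurable (G j)"
    and \<theta>_bounded: "\<And>j. j < m \<Longrightarrow> bounded (\<theta> j ` space M)"
  shows "(\<lambda>\<omega>. \<Sum>l<m. \<theta> l \<omega> * D l \<omega>) \<in> borel_measurable (G m)"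
    and "integrable M (\<lambda>\<omega>. (\<Sum>l<m. \<theta> l \<omega> * D l \<omega>)\<^sup>2)"
    and "expectation (\<lambda>\<omega>. (\<Sum>l<m. \<theta> l \<omega> * D l \<omega>)\<^sup>2) = expectation (\<lambda>\<omega>. \<Sum>l<m. v l * (\<theta> l \<omega>)\<^sup>2)"
proof -
  define N where "N j \<omega> = (\<Sum>l<j. \<theta> l \<omega> * D l \<omega>)" for j \<omega>
  have meas_M: "f \<in> borel_measurable M" if "f \<in> borel_measurable (G j)" for f :: "'a \<Rightarrow> real" and j
    using measurable_from_subalg[OF sub that] .
  have bnd: "\<exists>C. \<forall>\<omega>\<in>space M. \<bar>\<theta> j \<omega>\<bar> \<le> C" if "j < m" for j
    using \<theta>_bounded[OF that] by (auto simp: bounded_iff)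
  have \<theta>2_int: "integrable M (\<lambda>\<omega>. (\<theta> j \<omega>)\<^sup>2)" if "j < m" for j
  proof -
    obtain C where C: "\<forall>\<omega>\<in>space M. \<bar>\<theta> j \<omega>\<bar> \<le> C" using bnd[OF \<open>j < m\<close>] by auto
    have "AE \<omega> in M. norm ((\<theta> j \<omega>)\<^sup>2) \<le> C\<^sup>2"
    proof (intro AE_I2)
      fix \<omega> assume "\<omega> \<in> space M"
      then have "\<bar>\<theta> j \<omega>\<bar> \<le> C" using C by auto
      then show "norm ((\<theta> j \<omega>)\<^sup>2) \<le> C\<^sup>2" by (simp add: abs_le_square_iff[symmetric])
    qed
    then show ?thesis
      using meas_M[OF \<theta>_adapted[OF \<open>j < m\<close>]] by (intro integrable_const_bound) auto
  qed
  have "N j \<in> borel_measurable (G j) \<and> integrable M (\<lambda>\<omega>. (N j \<omega>)\<^sup>2) \<and>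
     expectation (\<lambda>\<omega>. (N j \<omega>)\<^sup>2) = expectation (\<lambda>\<omega>. \<Sum>l<j. v l * (\<theta> l \<omega>)\<^sup>2)" if "j \<le> m" for j
    using that
  proof (induction j)
    case 0
    then show ?case by (simp add: N_def)
  next
    case (Suc j)
    then have j: "j < m" by simp
    from Suc have IH: "N j \<in> borel_measurable (G j)" "integrable M (\<lambda>\<omega>. (N j \<omega>)\<^sup>2)"
       "expectation (\<lambda>\<omega>. (N j \<omega>)\<^sup>2) = expectation (\<lambda>\<omega>. \<Sum>l<j. v l * (\<theta> l \<omega>)\<^sup>2)" by auto
    note N_M [measurable] = meas_M[OF IH(1)]
    note \<theta>_M [measurable] = meas_M[OF \<theta>_adapted[OF j]]
    obtain C where C: "\<forall>\<omega>\<in>space M. \<bar>\<theta> j \<omega>\<bar> \<le> C" using bnd[OF j] by auto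
    have N_int: "integrable M (N j)"
      by (rule square_integrable_imp_integrable[OF N_M IH(2)])
    have N\<theta>_int: "integrable M (\<lambda>\<omega>. N j \<omega> * \<theta> j \<omega>)"
    proof (rule Bochner_Integration.integrable_bound[OF integrable_mult_right[OF N_int, of C]])
      show "AE \<omega> in M. norm (N j \<omega> * \<theta> j \<omega>) \<le> norm (C * N j \<omega>)"
      proof (intro AE_I2)
        fix \<omega> assume "\<omega> \<in> space M"
        then have "\<bar>\<theta> j \<omega>\<bar> \<le> \<bar>C\<bar>" using C by (meson abs_ge_self order_trans)
        then show "norm (N j \<omega> * \<theta> j \<omega>) \<le> norm (C * N j \<omega>)"
          by (simp add: abs_mult mult.commute[of "\<bar>N j \<omega>\<bar>"] mult_right_mono)
      qed
    qed measurable
    have ind1: "indep_var borel (\<lambda>\<omega>. N j \<omega> * \<theta> j \<omega>) borel (D j)"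
      by (intro D_indep j borel_measurable_times IH \<theta>_adapted)
    have ind2: "indep_var borel (\<lambda>\<omega>. (\<theta> j \<omega>)\<^sup>2) borel (\<lambda>\<omega>. (D j \<omega>)\<^sup>2)"
      using indep_var_compose[OF D_indep[OF j \<theta>_adapted[OF j]], of "\<lambda>x. x\<^sup>2" borel "\<lambda>x. x\<^sup>2" borel]
      by (simp add: o_def)
    have c1: "integrable M (\<lambda>\<omega>. N j \<omega> * \<theta> j \<omega> * D j \<omega>)"
      and e1: "expectation (\<lambda>\<omega>. N j \<omega> * \<theta> j \<omega> * D j \<omega>) = 0"
      using indep_var_integrable[OF ind1 N\<theta>_int D_int[OF j]]
        indep_var_lebesgue_integral[OF ind1 N\<theta>_int D_int[OF j]] D_mean[OF j] by auto
    have c2: "integrable M (\<lambda>\<omega>. (\<theta> j \<omega>)\<^sup>2 * (D j \<omega>)\<^sup>2)"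
      and e2: "expectation (\<lambda>\<omega>. (\<theta> j \<omega>)\<^sup>2 * (D j \<omega>)\<^sup>2) = v j * expectation (\<lambda>\<omega>. (\<theta> j \<omega>)\<^sup>2)"
      using indep_var_integrable[OF ind2 \<theta>2_int[OF j] D2_int[OF j]]
        indep_var_lebesgue_integral[OF ind2 \<theta>2_int[OF j] D2_int[OF j]] D2_mean[OF j] by auto
    have N_Suc: "N (Suc j) \<omega> = N j \<omega> + \<theta> j \<omega> * D j \<omega>" for \<omega> by (simp add: N_def)
    have sq: "(N (Suc j) \<omega>)\<^sup>2 = (N j \<omega>)\<^sup>2 + 2 * (N j \<omega> * \<theta> j \<omega> * D j \<omega>) + (\<theta> j \<omega>)\<^sup>2 * (D j \<omega>)\<^sup>2"
        for \<omega>
      by (simp add: N_Suc power2_eq_square algebra_simps)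
    have "N (Suc j) \<in> borel_measurable (G (Suc j))"
      unfolding N_Suc[abs_def]
      by (intro borel_measurable_add borel_measurable_times D_adapted j
            measurable_from_subalg[OF mono] IH \<theta>_adapted)
    moreover have "integrable M (\<lambda>\<omega>. (N (Suc j) \<omega>)\<^sup>2)"
      unfolding sq by (intro Bochner_Integration.integrable_add IH c2 integrable_mult_right c1)
    moreover have "expectation (\<lambda>\<omega>. (N (Suc j) \<omega>)\<^sup>2) = expectation (\<lambda>\<omega>. \<Sum>l<Suc j. v l * (\<theta> l \<omega>)\<^sup>2)"
    proof -
      have "expectation (\<lambda>\<omega>. (N (Suc j) \<omega>)\<^sup>2) =
         expectation (\<lambda>\<omega>. \<Sum>l<j. v l * (\<theta> l \<omega>)\<^sup>2) + v j * expectation (\<lambda>\<omega>. (\<theta> j \<omega>)\<^sup>2)"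
        unfolding sq using IH(2,3) c1 c2 e1 e2
        by (simp add: Bochner_Integration.integral_add)
      also have "\<dots> = expectation (\<lambda>\<omega>. \<Sum>l<Suc j. v l * (\<theta> l \<omega>)\<^sup>2)"
      proof -
        have "integrable M (\<lambda>\<omega>. \<Sum>l<j. v l * (\<theta> l \<omega>)\<^sup>2)"
          using j by (intro Bochner_Integration.integrable_sum integrable_mult_right \<theta>2_int) auto
        then show ?thesis
          using \<theta>2_int[OF j] by (simp add: Bochner_Integration.integral_add)
      qed
      finally show ?thesis .
    qed
    ultimately show ?case by blast
  qed
  from this[of m] show "(\<lambda>\<omega>. \<Sum>l<m. \<theta> l \<omega> * D l \<omega>) \<in> borel_measurable (G m)"
    "integrable M (\<lambda>\<omega>. (\<Sum>l<m. \<theta> l \<omega> * D l \<omega>)\<^sup>2)"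
    "expectation (\<lambda>\<omega>. (\<Sum>l<m. \<theta> l \<omega> * D l \<omega>)\<^sup>2) = expectation (\<lambda>\<omega>. \<Sum>l<m. v l * (\<theta> l \<omega>)\<^sup>2)"
    unfolding N_def by auto
qed

text \<open>
  Stop the transform at the first time when it reaches \<open>r\<close> in absolute value, or when the next step
  would push the quadratic variation above \<open>\<delta>\<close>; both are decided before the next increment is seen.
  The stopped transform has second moment at most \<open>\<delta>\<close>. On the event in question the second
  reason never applies, so the stopped transform keeps the value with which the original one first
  reached \<open>r\<close>, and Markov's inequality for the square finishes the proof.
\<close>
lemma martingale_transform_maximal_inequality:
  fixes G :: "nat \<Rightarrow> 'a measure" and \<eta> D :: "nat \<Rightarrow> 'a \<Rightarrow> real" and v :: "nat \<Rightarrow> real"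
  assumes sub: "\<And>j. subalgebra M (G j)"
    and mono: "\<And>j. subalgebra (G (Suc j)) (G j)"
    and D_adapted: "\<And>j. j < m \<Longrightarrow> D j \<in> borel_measurable (G (Suc j))"
    and D_indep: "\<And>j g. j < m \<Longrightarrow> g \<in> borel_measurable (G j) \<Longrightarrow> indep_var borel g borel (D j)"
    and D_int: "\<And>j. j < m \<Longrightarrow> integrable M (D j)"
    and D_mean: "\<And>j. j < m \<Longrightarrow> expectation (D j) = 0"
    and D2_int: "\<And>j. j < m \<Longrightarrow> integrable M (\<lambda>\<omega>. (D j \<omega>)\<^sup>2)"
    and D2_mean: "\<And>j. j < m \<Longrightarrow> expectation (\<lambda>\<omega>. (D j \<omega>)\<^sup>2) = v j"
    and v_nonneg: "\<And>j. j < m \<Longrightarrow> 0 \<le> v j"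
    and \<eta>_adapted: "\<And>j. j < m \<Longrightarrow> \<eta> j \<in> borel_measurable (G j)"
    and \<eta>_bounded: "\<And>j. j < m \<Longrightarrow> bounded (\<eta> j ` space M)"
    and "0 < r" "0 \<le> \<delta>"
  shows "prob {\<omega> \<in> space M. (\<exists>j\<le>m. r \<le> \<bar>\<Sum>l<j. \<eta> l \<omega> * D l \<omega>\<bar>) \<and> (\<Sum>l<m. v l * (\<eta> l \<omega>)\<^sup>2) \<le> \<delta>}
     \<le> \<delta> / r\<^sup>2"
proof -
  define S where "S j \<omega> = (\<Sum>l<j. \<eta> l \<omega> * D l \<omega>)" for j \<omega>
  define Q where "Q j \<omega> = (\<Sum>l<j. v l * (\<eta> l \<omega>)\<^sup>2)" for j \<omega>
  define go where "go l \<omega> \<longleftrightarrow> (\<forall>i\<le>l. \<bar>S i \<omega>\<bar> < r) \<and> Q (Suc l) \<omega> \<le> \<delta>" for l \<omega>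
  \<comment> \<open>The coefficients of the stopped transform; \<open>Q (Suc l)\<close> is known before the increment \<open>D l\<close>.\<close>
  define \<theta> where "\<theta> l \<omega> = (if go l \<omega> then \<eta> l \<omega> else 0)" for l \<omega>
  define N where "N \<omega> = (\<Sum>l<m. \<theta> l \<omega> * D l \<omega>)" for \<omega>
  have up: "f \<in> borel_measurable (G j)" if "i \<le> j" "f \<in> borel_measurable (G i)"
    for f :: "'a \<Rightarrow> real" and i j
    using that
  proof (induction rule: dec_induct)
    case (step n)
    then show ?case by (intro measurable_from_subalg[OF mono]) simp
  qed
  have S_adapted: "S j \<in> borel_measurable (G j)" if "j \<le> m" for j
    unfolding S_def[abs_def] using that
    by (intro borel_measurable_sum borel_measurable_times)
       (auto intro!: up[OF _ \<eta>_adapted] up[OF _ D_adapted])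
  have Q_adapted: "Q (Suc j) \<in> borel_measurable (G j)" if "j < m" for j
    unfolding Q_def[abs_def] using that
    by (intro borel_measurable_sum borel_measurable_times borel_measurable_power)
       (auto intro!: up[OF _ \<eta>_adapted])
  have \<theta>_adapted: "\<theta> j \<in> borel_measurable (G j)" if "j < m" for j
  proof -
    have [measurable]: "S i \<in> borel_measurable (G j)" if "i \<le> j" for i
      using up[OF that S_adapted] that \<open>j < m\<close> by auto
    note [measurable] = Q_adapted[OF that] \<eta>_adapted[OF that]
    have [measurable]: "Measurable.pred (G j) (\<lambda>\<omega>. \<forall>i\<in>{..j}. \<bar>S i \<omega>\<bar> < r)"
      by (intro pred_intros_finite) (auto intro!: borel_measurable_pred_less)
    then have [measurable]: "Measurable.pred (G j) (go j)"
      unfolding go_def[abs_def] by (simp add: Ball_def)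
    show ?thesis unfolding \<theta>_def[abs_def] by measurable
  qed
  have \<theta>_bounded: "bounded (\<theta> j ` space M)" if "j < m" for j
    by (rule bounded_subset[of "insert 0 (\<eta> j ` space M)"])
      (auto simp: \<theta>_def \<eta>_bounded[OF that])
  note moment = orthogonal_sum_second_moment[where G=G and m=m and D=D and v=v and \<theta>=\<theta>,
      OF sub mono D_adapted D_indep D_int D_mean D2_int
      D2_mean \<theta>_adapted \<theta>_bounded, folded N_def]
  have N_M [measurable]: "N \<in> borel_measurable M"
    by (rule measurable_from_subalg[OF sub moment(1)])
  have QV: "(\<Sum>l<m. v l * (\<theta> l \<omega>)\<^sup>2) \<le> \<delta>" for \<omega>
  proof -
    let ?c = "\<lambda>l. if l < m then v l * (\<eta> l \<omega>)\<^sup>2 else 0"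
    have "(\<Sum>l<m. v l * (\<theta> l \<omega>)\<^sup>2) =
       (\<Sum>l<m. if (\<Sum>i<Suc l. ?c i) \<le> \<delta> \<and> (\<forall>i\<le>l. \<bar>S i \<omega>\<bar> < r) then ?c l else 0)"
    proof (intro sum.cong refl)
      fix l assume "l \<in> {..<m}"
      then have "(\<Sum>i<Suc l. ?c i) = Q (Suc l) \<omega>" unfolding Q_def by (intro sum.cong) auto
      then show "v l * (\<theta> l \<omega>)\<^sup>2 =
         (if (\<Sum>i<Suc l. ?c i) \<le> \<delta> \<and> (\<forall>i\<le>l. \<bar>S i \<omega>\<bar> < r) then ?c l else 0)"
        using \<open>l \<in> {..<m}\<close> by (auto simp: \<theta>_def go_def)
    qed
    also have "\<dots> \<le> \<delta>"
      by (rule truncated_sum_le[where c="?c" and P="\<lambda>l. \<forall>i\<le>l. \<bar>S i \<omega>\<bar> < r"])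
          (simp_all add: v_nonneg \<open>0 \<le> \<delta>\<close>)
    finally show ?thesis .
  qed
  have N2: "expectation (\<lambda>\<omega>. (N \<omega>)\<^sup>2) \<le> \<delta>"
  proof -
    have "expectation (\<lambda>\<omega>. (N \<omega>)\<^sup>2) = expectation (\<lambda>\<omega>. \<Sum>l<m. v l * (\<theta> l \<omega>)\<^sup>2)"
      by (rule moment(3))
    also have "\<dots> \<le> expectation (\<lambda>\<omega>. \<delta>)"
      by (rule integral_mono') (simp_all add: QV \<open>0 \<le> \<delta>\<close>)
    finally show ?thesis by (simp add: prob_space)
  qed
  have hit: "r \<le> \<bar>N \<omega>\<bar>" if j: "j \<le> m" "r \<le> \<bar>S j \<omega>\<bar>" and Qm: "Q m \<omega> \<le> \<delta>" for \<omega> j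
  proof -
    define i where "i = (LEAST i. r \<le> \<bar>S i \<omega>\<bar>)"
    have i: "r \<le> \<bar>S i \<omega>\<bar>" "i \<le> j" "\<And>k. k < i \<Longrightarrow> \<bar>S k \<omega>\<bar> < r"
      unfolding i_def using j(2)
      by (rule LeastI[of _ j], rule Least_le) (meson not_le not_less_Least)
    have Q_le: "Q k \<omega> \<le> \<delta>" if "k \<le> m" for k
    proof -
      have "Q k \<omega> \<le> Q m \<omega>" unfolding Q_def using that v_nonneg
        by (intro sum_mono2) auto
      with Qm show ?thesis by simp
    qed
    have "N \<omega> = (\<Sum>l<m. if l < i then \<eta> l \<omega> * D l \<omega> else 0)"
      unfolding N_def
    proof (intro sum.cong refl)
      fix l assume l: "l \<in> {..<m}"
      have "go l \<omega> \<longleftrightarrow> l < i"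
      proof
        assume "go l \<omega>"
        then have "\<not> i \<le> l" using i(1) unfolding go_def by fastforce
        then show "l < i" by simp
      next
        assume "l < i"
        then show "go l \<omega>" using i(3) Q_le[of "Suc l"] l unfolding go_def by simp
      qed
      then show "\<theta> l \<omega> * D l \<omega> = (if l < i then \<eta> l \<omega> * D l \<omega> else 0)"
        by (simp add: \<theta>_def)
    qed
    also have "\<dots> = (\<Sum>l\<in>{..<m} \<inter> {l. l < i}. \<eta> l \<omega> * D l \<omega>)"
      by (simp add: sum.inter_restrict)
    also have "{..<m} \<inter> {l. l < i} = {..<i}" using i(2) j(1) by auto
    finally show ?thesis using i(1) by (simp add: S_def)
  qed
  have "prob {\<omega> \<in> space M. (\<exists>j\<le>m. r \<le> \<bar>S j \<omega>\<bar>) \<and> Q m \<omega> \<le> \<delta>} \<le> prob {\<omega> \<in> space M. r\<^sup>2 \<le> (N \<omega>)\<^sup>2}"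
  proof (rule finite_measure_mono)
    show "{\<omega> \<in> space M. (\<exists>j\<le>m. r \<le> \<bar>S j \<omega>\<bar>) \<and> Q m \<omega> \<le> \<delta>} \<subseteq> {\<omega> \<in> space M. r\<^sup>2 \<le> (N \<omega>)\<^sup>2}"
      using hit \<open>0 < r\<close> by (auto simp: abs_le_square_iff[symmetric])
  qed measurable
  also have "\<dots> \<le> expectation (\<lambda>\<omega>. (N \<omega>)\<^sup>2) / r\<^sup>2"
  proof (rule integral_Markov_inequality_measure[where A="{}"])
    show "integrable M (\<lambda>\<omega>. (N \<omega>)\<^sup>2)" by (rule moment(2))
  qed (use \<open>0 < r\<close> in simp_all)
  also have "\<dots> \<le> \<delta> / r\<^sup>2" using N2 by (intro divide_right_mono) auto
  finally show ?thesis unfolding S_def Q_def .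
qed

end

section \<open>Independence of Brownian increments from the past\<close>

text \<open>
  The enumeration stays at \<open>b\<close> after index \<open>m\<close>, so that it is a monotone map on all of \<open>nat\<close> and
  filtrations can be sampled along it at every index.
\<close>
definition is_grid :: "real set \<Rightarrow> real \<Rightarrow> real \<Rightarrow> (nat \<Rightarrow> real) \<Rightarrow> nat \<Rightarrow> bool" where
  "is_grid A a b \<sigma> m \<longleftrightarrow>
     \<sigma> 0 = a \<and> \<sigma> m = b \<and> mono \<sigma> \<and> (\<forall>i. \<sigma> i \<in> {a..b}) \<and> \<sigma> ` {..m} = A"

lemma finite_grid:
  fixes A :: "real set"
  assumes A: "finite A" "a \<in> A" "b \<in> A" "A \<subseteq> {a..b}"
  shows "\<exists>\<sigma> m. is_grid A a b \<sigma> m"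
proof -
  define ts where "ts = sorted_list_of_set A"
  define m where "m = length ts - 1"
  define \<sigma> where "\<sigma> i = ts ! min i m" for i
  have ts: "sorted ts" "set ts = A" using A by (auto simp: ts_def)
  have len: "length ts = Suc m" using A(2) ts(2) by (cases ts) (auto simp: m_def)
  have in_A: "\<sigma> i \<in> A" for i
    unfolding \<sigma>_def ts(2)[symmetric] by (rule nth_mem) (simp add: len less_Suc_eq_le)
  have mono: "\<sigma> i \<le> \<sigma> j" if "i \<le> j" for i j
    unfolding \<sigma>_def by (rule sorted_nth_mono[OF ts(1)]) (use that len
        in \<open>simp_all add: min_le_iff_disj\<close>)
  have onto: "\<exists>i\<le>m. \<sigma> i = x" if "x \<in> A" for x
  proof -
    have "x \<in> set ts" using that ts(2) by simp
    then obtain i where "i < length ts" "ts ! i = x" unfolding in_set_conv_nth by blast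
    then show ?thesis using len by (intro exI[of _ i]) (simp add: \<sigma>_def less_Suc_eq_le)
  qed
  obtain i j where ij: "i \<le> m" "\<sigma> i = a" "j \<le> m" "\<sigma> j = b" using onto[OF A(2)] onto[OF A(3)]
      by blast
  have bounds: "a \<le> \<sigma> k" "\<sigma> k \<le> b" for k using in_A[of k] A(4) by auto
  have "\<sigma> 0 = a" using mono[of 0 i] ij bounds[of 0] by simp
  moreover have "\<sigma> m = b" using mono[of j m] ij bounds[of m] by simp
  moreover have "\<sigma> ` {..m} = A"
  proof
    show "\<sigma> ` {..m} \<subseteq> A" using in_A by blast
    show "A \<subseteq> \<sigma> ` {..m}" using onto by (metis atMost_iff image_eqI subsetI)
  qed
  ultimately have "is_grid A a b \<sigma> m" using mono bounds unfolding is_grid_def by (auto intro: monoI)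
  then show ?thesis by blast
qed

definition past_events :: "'a measure \<Rightarrow> (real \<Rightarrow> 'a \<Rightarrow> real) \<Rightarrow> real \<Rightarrow> 'a set set" where
  "past_events M B s = sigma_sets (space M) {B u -` A \<inter> space M | u A. 0 \<le> u \<and> u
      \<le> s \<and> A \<in> sets borel}"

text \<open>
  An intersection-stable generator of the past.
\<close>
definition cylinders :: "'a measure \<Rightarrow> (real \<Rightarrow> 'a \<Rightarrow> real) \<Rightarrow> real \<Rightarrow> 'a set set" where
  "cylinders M B s = {{\<omega> \<in> space M. \<forall>u\<in>J. B u \<omega> \<in> A u} | J A.
     finite J \<and> J \<subseteq> {0..s} \<and> (\<forall>u\<in>J. A u \<in> sets borel)}"

lemma Int_stable_preimages: "Int_stable {X -` A \<inter> S | A. A \<in> sets N}"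
proof (rule Int_stableI)
  fix a b assume "a \<in> {X -` A \<inter> S | A. A \<in> sets N}" "b \<in> {X -` A \<inter> S | A. A \<in> sets N}"
  then obtain A B where "a = X -` A \<inter> S" "b = X -` B \<inter> S" "A \<in> sets N" "B \<in> sets N" by auto
  then show "a \<inter> b \<in> {X -` A \<inter> S | A. A \<in> sets N}"
    by (intro CollectI exI[of _ "A \<inter> B"]) auto
qed

lemma Int_stable_cylinders: "Int_stable (cylinders M B s)"
proof (rule Int_stableI)
  fix a b assume "a \<in> cylinders M B s" "b \<in> cylinders M B s"
  then obtain J A J' A' where a: "a = {\<omega> \<in> space M. \<forall>u\<in>J. B u \<omega> \<in> A u}"
      "finite J" "J \<subseteq> {0..s}" "\<forall>u\<in>J. A u \<in> sets borel"
    and b: "b = {\<omega> \<in> space M. \<forall>u\<in>J'. B u \<omega> \<in> A' u}"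
      "finite J'" "J' \<subseteq> {0..s}" "\<forall>u\<in>J'. A' u \<in> sets borel"
    by (auto simp: cylinders_def)
  \<comment> \<open>Times that occur in only one of the two cylinders are unconstrained in the other.\<close>
  let ?A = "\<lambda>u. (if u \<in> J then A u else UNIV) \<inter> (if u \<in> J' then A' u else UNIV)"
  have "a \<inter> b = {\<omega> \<in> space M. \<forall>u\<in>J \<union> J'. B u \<omega> \<in> ?A u}"
    unfolding a(1) b(1) by auto
  then show "a \<inter> b \<in> cylinders M B s"
    unfolding cylinders_def using a b by (intro CollectI exI[of _ "J \<union> J'"] exI[of _ ?A]) auto
qed

lemma past_events_subset_cylinders: "past_events M B s \<subseteq> sigma_sets (space M) (cylinders M B s)"
proof -
  have "{B u -` A \<inter> space M | u A. 0 \<le> u \<and> u \<le> s \<and> A \<in> sets borel} \<subseteq> cylinders M B s"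
  proof safe
    fix u :: real and A :: "real set" assume "0 \<le> u" "u \<le> s" "A \<in> sets borel"
    then show "B u -` A \<inter> space M \<in> cylinders M B s"
      unfolding cylinders_def by (intro CollectI exI[of _ "{u}"] exI[of _ "\<lambda>_. A"]) auto
  qed
  then show ?thesis unfolding past_events_def by (rule sigma_sets_mono')
qed

context brownian_motion
begin

lemma cylinders_events: "cylinders M B s \<subseteq> events"
proof
  fix a assume "a \<in> cylinders M B s"
  then obtain J A where a: "a = {\<omega> \<in> space M. \<forall>u\<in>J. B u \<omega> \<in> A u}"
      "finite J" "J \<subseteq> {0..s}" "\<forall>u\<in>J. A u \<in> sets borel"
    by (auto simp: cylinders_def)
  have "{\<omega> \<in> space M. B u \<omega> \<in> A u} \<in> events" if "u \<in> J" for u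
    using measurable_sets[OF measurable_at[of u], of "A u"] a that
    by (auto simp: vimage_def Int_def conj_commute)
  then show "a \<in> events" unfolding a(1) using a(2) by (intro sets.sets_Collect_finite_All) auto
qed

text \<open>
  Sort the finitely many times of the cylinder. Up to a null set (where the motion does not start at
  \<open>0\<close>), the cylinder is determined by the increments between consecutive times, which are jointly
  independent of the final increment from \<open>s\<close> to \<open>t\<close>.
\<close>
lemma cylinder_indep_increment:
  assumes "0 \<le> s" "s \<le> t" "g \<in> cylinders M B s" "A \<in> sets borel"
  shows "prob (g \<inter> ((\<lambda>\<omega>. B t \<omega> - B s \<omega>) -` A \<inter> space M)) =
    prob g * prob ((\<lambda>\<omega>. B t \<omega> - B s \<omega>) -` A \<inter> space M)"
proof -
  from assms obtain J C where g: "g = {\<omega> \<in> space M. \<forall>u\<in>J. B u \<omega> \<in> C u}"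
      "finite J" "J \<subseteq> {0..s}" "\<forall>u\<in>J. C u \<in> sets borel"
    by (auto simp: cylinders_def)
  define K where "K = insert 0 (insert s J)"
  have K: "finite K" "0 \<in> K" "s \<in> K" "K \<subseteq> {0..s}" using g assms by (auto simp: K_def)
  obtain \<sigma> n where "is_grid K 0 s \<sigma> n" using finite_grid[OF K] by blast
  then have \<sigma>: "\<sigma> 0 = 0" "\<sigma> n = s" "mono \<sigma>" "\<sigma> ` {..n} = K" by (simp_all add: is_grid_def)
  define \<tau> where "\<tau> i = (if i \<le> n then \<sigma> i else t)" for i
  have \<tau>0: "\<tau> 0 = 0" and \<tau>n: "\<tau> n = s" by (simp_all add: \<tau>_def \<sigma>(1,2))
  have mono: "\<tau> i \<le> \<tau> (Suc i)" if "i < Suc n" for i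
  proof (cases "i = n")
    case True then show ?thesis using assms(2) \<tau>n by (simp add: \<tau>_def[of "Suc n"])
  next
    case False then show ?thesis using that monoD[OF \<sigma>(3), of i "Suc i"] by (simp add: \<tau>_def)
  qed
  define inc where "inc i \<omega> = B (\<tau> (Suc i)) \<omega> - B (\<tau> i) \<omega>" for i \<omega>
  have inc_n: "inc n = (\<lambda>\<omega>. B t \<omega> - B s \<omega>)"
    by (simp add: inc_def[abs_def] \<tau>n) (simp add: \<tau>_def)
  have "indep_vars (\<lambda>_. borel) inc {..<Suc n}"
    unfolding inc_def[abs_def] by (rule indep_increments) (use \<tau>0 mono in auto)
  then have inc_M: "\<And>i. i < Suc n \<Longrightarrow> random_variable borel (inc i)"
    and ind: "indep_sets (\<lambda>i. {inc i -` A \<inter> space M | A. A \<in> sets borel}) {..<Suc n}"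
    by (auto simp: indep_vars_def2)
  have "indep_sets (\<lambda>b. sigma_sets (space M) (\<Union>i\<in>case_bool {..<n} {n} b. {inc i -` A \<inter> space M | A. A \<in> sets borel})) UNIV"
  proof (rule indep_sets_collect_sigma)
    have "(\<Union>j\<in>UNIV. case_bool {..<n} {n} j) = {..<Suc n}" by (auto simp: UNIV_bool)
    then show "indep_sets (\<lambda>i. {inc i -` A \<inter> space M | A. A \<in> sets borel}) (\<Union>j\<in>UNIV. case_bool {..<n} {n} j)"
      using ind by simp
    show "Int_stable {inc i -` A \<inter> space M | A. A \<in> sets borel}" for i
      by (rule Int_stable_preimages)
    show "disjoint_family_on (case_bool {..<n} {n}) UNIV"
      by (auto simp: disjoint_family_on_def split: bool.splits)
  qed
  moreover have "(\<lambda>b. sigma_sets (space M) (\<Union>i\<in>case_bool {..<n} {n} b. {inc i -` A \<inter> space M | A. A \<in> sets borel})) =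
     case_bool (sigma_sets (space M) (\<Union>i<n. {inc i -` A \<inter> space M | A. A \<in> sets borel}))
               (sigma_sets (space M) {inc n -` A \<inter> space M | A. A \<in> sets borel})"
    by (auto simp: fun_eq_iff split: bool.splits)
  ultimately have indep: "indep_set (sigma_sets (space M) (\<Union>i<n. {inc i -` A \<inter> space M | A. A \<in> sets borel}))
               (sigma_sets (space M) {inc n -` A \<inter> space M | A. A \<in> sets borel})"
    by (simp add: indep_set_def)
  define N where "N = sigma (space M) (\<Union>i<n. {inc i -` A \<inter> space M | A. A \<in> sets borel})"
  have sets_N: "sets N = sigma_sets (space M) (\<Union>i<n. {inc i -` A \<inter> space M | A. A \<in> sets borel})"
    and space_N: "space N = space M"
    unfolding N_def by (auto intro!: sets_measure_of space_measure_of)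
  have inc_N: "inc i \<in> borel_measurable N" if "i < n" for i
    by (rule measurableI) (use that in \<open>auto simp: sets_N space_N intro!: sigma_sets.Basic\<close>)
  define idx where "idx u = (SOME i. i \<le> n \<and> \<sigma> i = u)" for u
  have idx: "idx u \<le> n" "\<tau> (idx u) = u" if "u \<in> J" for u
  proof -
    have "u \<in> \<sigma> ` {..n}" using \<sigma>(4) that by (simp add: K_def)
    then have "\<exists>i. i \<le> n \<and> \<sigma> i = u" by auto
    from someI_ex[OF this] show "idx u \<le> n" "\<tau> (idx u) = u" by (auto simp: idx_def \<tau>_def)
  qed
  define g' where "g' = {\<omega> \<in> space M. \<forall>u\<in>J. (\<Sum>i<idx u. inc i \<omega>) \<in> C u}"
  have g'_N: "g' \<in> sets N"
  proof -
    have "{\<omega> \<in> space N. (\<Sum>i<idx u. inc i \<omega>) \<in> C u} \<in> sets N" if "u \<in> J" for u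
    proof -
      have "(\<lambda>\<omega>. \<Sum>i<idx u. inc i \<omega>) \<in> borel_measurable N"
        using idx[OF that] by (intro borel_measurable_sum inc_N) auto
      from measurable_sets[OF this, of "C u"] show ?thesis
        using g(4) that by (auto simp: vimage_def Int_def conj_commute)
    qed
    then have "{\<omega> \<in> space N. \<forall>u\<in>J. (\<Sum>i<idx u. inc i \<omega>) \<in> C u} \<in> sets N"
      using g(2) by (intro sets.sets_Collect_finite_All) auto
    then show ?thesis by (simp add: g'_def space_N)
  qed
  have telescope: "(\<Sum>i<k. inc i \<omega>) = B (\<tau> k) \<omega> - B 0 \<omega>" for k \<omega>
    unfolding inc_def using sum_lessThan_telescope[of "\<lambda>i. B (\<tau> i) \<omega>" k] by (simp add: \<tau>0)
  have ae: "AE \<omega> in M. \<omega> \<in> g \<longleftrightarrow> \<omega> \<in> g'"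
    using starts_at_0 by eventually_elim (auto simp: g(1) g'_def telescope idx)
  have g_M: "g \<in> events" using cylinders_events assms(3) by auto
  have g'_M: "g' \<in> events" using indep_setD_ev1[OF indep] g'_N sets_N by auto
  define d where "d = (\<lambda>\<omega>. B t \<omega> - B s \<omega>) -` A \<inter> space M"
  have d: "d \<in> sigma_sets (space M) {inc n -` A \<inter> space M | A. A \<in> sets borel}"
    unfolding d_def inc_n using assms(4) by (auto intro!: sigma_sets.Basic)
  have d_M: "d \<in> events" using indep_setD_ev2[OF indep] d by auto
  have "prob (g \<inter> d) = prob (g' \<inter> d)"
    using ae by (intro finite_measure_eq_AE sets.Int g_M g'_M d_M) auto
  also have "\<dots> = prob g' * prob d"
    by (rule indep_setD[OF indep _ d]) (use g'_N sets_N in auto)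
  also have "prob g' = prob g"
    using ae by (intro finite_measure_eq_AE g_M g'_M) auto
  finally show ?thesis by (simp add: d_def)
qed

lemma past_indep_increment:
  assumes "0 \<le> s" "s \<le> t"
  shows "indep_set (past_events M B s) {(\<lambda>\<omega>. B t \<omega> - B s \<omega>) -` A \<inter> space M | A. A \<in> sets borel}"
proof -
  let ?D = "\<lambda>\<omega>. B t \<omega> - B s \<omega>"
  have D: "random_variable borel ?D"
    using assms by (intro borel_measurable_diff measurable_at) auto
  have ind: "indep_set (cylinders M B s) {?D -` A \<inter> space M | A. A \<in> sets borel}"
  proof (rule indep_setI[OF cylinders_events])
    show "{?D -` A \<inter> space M | A. A \<in> sets borel} \<subseteq> events"
      using measurable_sets[OF D] by auto
  qed (use cylinder_indep_increment[OF assms] in auto)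
  have "indep_set (sigma_sets (space M) (cylinders M B s))
     (sigma_sets (space M) {?D -` A \<inter> space M | A. A \<in> sets borel})"
    by (intro indep_set_sigma_sets ind Int_stable_cylinders)
      (rule Int_stable_preimages)
  then show ?thesis
    unfolding indep_set_def
    by (rule indep_sets_mono_sets)
      (use past_events_subset_cylinders[of M B s]
          in \<open>auto split: bool.splits intro: sigma_sets.Basic\<close>)
qed

end

text \<open>
  This form matches the sets whose independence \<open>indep_processes\<close> asserts.
\<close>
lemma past_events_subset_process_events:
  "past_events M B s \<subseteq>
     {(\<lambda>\<omega>. \<lambda>t\<in>{0..}. B t \<omega>) -` A \<inter> space M | A. A \<in> sets (Pi\<^sub>M {0..} (\<lambda>_. borel))}"
proof -
  let ?X = "\<lambda>\<omega>. \<lambda>t\<in>{0..}. B t \<omega>" and ?P = "Pi\<^sub>M {0..} (\<lambda>_. borel :: real measure)"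
  let ?V = "vimage_algebra (space M) ?X ?P"
  have "past_events M B s \<subseteq> sigma_sets (space ?V) (sets ?V)"
    unfolding past_events_def space_vimage_algebra
  proof (rule sigma_sets_mono', safe)
    fix u :: real and A :: "real set" assume u: "0 \<le> u" "A \<in> sets borel"
    have "(\<lambda>x. x u) -` A \<inter> space ?P \<in> sets ?P"
      by (rule measurable_sets[OF measurable_component_singleton]) (use u in auto)
    from in_vimage_algebra[OF this, of ?X "space M"] u
    show "B u -` A \<inter> space M \<in> sets ?V"
      by (simp add: vimage_def Int_def space_PiM PiE_def conj_commute cong: conj_cong)
  qed
  also have "\<dots> = sets ?V" by (rule sets.sigma_sets_eq)
  also have "\<dots> = {?X -` A \<inter> space M | A. A \<in> sets ?P}"
    by (rule sets_vimage_algebra2) (auto simp: space_PiM)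
  finally show ?thesis .
qed

section \<open>Brownian motion relative to a filtration\<close>

text \<open>
  Independence is stated for real random variables measurable with respect to the past, which is how
  the second-moment computation consumes it.
\<close>
locale filtered_brownian_motion = brownian_motion M B
  for M :: "'a measure" and B :: "real \<Rightarrow> 'a \<Rightarrow> real" +
  fixes F :: "real \<Rightarrow> 'a measure"
  assumes filtration_sub: "\<And>s. 0 \<le> s \<Longrightarrow> subalgebra M (F s)"
    and filtration_mono: "\<And>s t. 0 \<le> s \<Longrightarrow> s \<le> t \<Longrightarrow> subalgebra (F t) (F s)"
    and adapted: "\<And>t. 0 \<le> t \<Longrightarrow> B t \<in> borel_measurable (F t)"
    and increment_indep: "\<And>s t g. 0 \<le> s \<Longrightarrow> s \<le> t \<Longrightarrow> g \<in> borel_measurable (F s) \<Longrightarrow>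
          indep_var borel g borel (\<lambda>\<omega>. B t \<omega> - B s \<omega>)"

lemma (in brownian_motion) increment_moments:
  assumes "0 \<le> s" "s \<le> t"
  shows "integrable M (\<lambda>\<omega>. B t \<omega> - B s \<omega>)"
    and "expectation (\<lambda>\<omega>. B t \<omega> - B s \<omega>) = 0"
    and "integrable M (\<lambda>\<omega>. (B t \<omega> - B s \<omega>)\<^sup>2)"
    and "expectation (\<lambda>\<omega>. (B t \<omega> - B s \<omega>)\<^sup>2) = t - s"
proof -
  have "integrable M (\<lambda>\<omega>. B t \<omega> - B s \<omega>) \<and> expectation (\<lambda>\<omega>. B t \<omega> - B s \<omega>) = 0 \<and>
    integrable M (\<lambda>\<omega>. (B t \<omega> - B s \<omega>)\<^sup>2) \<and> expectation (\<lambda>\<omega>. (B t \<omega> - B s \<omega>)\<^sup>2) = t - s"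
  proof (cases "s = t")
    case False
    then have "s < t" using assms by simp
    note D = normal_increments[OF assms(1) this]
    have pos: "0 < sqrt (t - s)" using \<open>s < t\<close> by simp
    have e: "expectation (\<lambda>\<omega>. B t \<omega> - B s \<omega>) = 0"
      using normal_distributed_expectation[OF pos D] .
    have v: "expectation (\<lambda>\<omega>. (B t \<omega> - B s \<omega>)\<^sup>2) = t - s"
      using normal_distributed_variance[OF pos D] e \<open>s < t\<close> by simp
    have "integrable M (\<lambda>\<omega>. B t \<omega> - B s \<omega>)"
      by (subst distributed_integrable[OF D, of "\<lambda>x. x", symmetric])
        (use integrable_normal_moment[OF pos, of 0 1] in auto)
    moreover have "integrable M (\<lambda>\<omega>. (B t \<omega> - B s \<omega>)\<^sup>2)"
      by (subst distributed_integrable[OF D, of "\<lambda>x. x\<^sup>2", symmetric])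
        (use integrable_normal_moment[OF pos, of 0 2] in auto)
    ultimately show ?thesis using e v by blast
  qed simp
  then show "integrable M (\<lambda>\<omega>. B t \<omega> - B s \<omega>)"
    "expectation (\<lambda>\<omega>. B t \<omega> - B s \<omega>) = 0"
    "integrable M (\<lambda>\<omega>. (B t \<omega> - B s \<omega>)\<^sup>2)"
    "expectation (\<lambda>\<omega>. (B t \<omega> - B s \<omega>)\<^sup>2) = t - s" by blast+
qed

text \<open>
  Adjoin the increment of the \<open>k\<close>-th process as one more member to the family of the pasts of all
  processes. The enlarged family is still independent: the past and the increment of the \<open>k\<close>-th
  process are independent of each other, and their intersection is an event of that process, hence
  independent of the others. The joint past is generated by the old members of the family.
\<close>
lemma (in prob_space) independent_past_and_increment:
  assumes ind: "indep_processes Bs" and bm: "\<And>i. i < length Bs \<Longrightarrow> brownian_motion M (Bs ! i)"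
    and k: "k < length Bs" and st: "0 \<le> s" "s \<le> t"
  shows "indep_set (sets (natural_filtration M Bs s))
     (sigma_sets (space M) {(\<lambda>\<omega>. (Bs ! k) t \<omega> - (Bs ! k) s \<omega>) -` A \<inter> space M | A. A \<in> sets borel})"
proof -
  let ?n = "length Bs"
  let ?E = "\<lambda>i. {(\<lambda>\<omega>. \<lambda>t\<in>{0..}. (Bs ! i) t \<omega>) -` A \<inter> space M | A. A \<in> sets (Pi\<^sub>M {0..}
      (\<lambda>_. borel))}"
  let ?D = "\<lambda>\<omega>. (Bs ! k) t \<omega> - (Bs ! k) s \<omega>"
  let ?I = "{?D -` A \<inter> space M | A. A \<in> sets borel}"
  define G where "G i = (if i < ?n then past_events M (Bs ! i) s else ?I)" for i
  have E: "indep_sets ?E {..<?n}"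
    using ind unfolding indep_processes_def indep_vars_def2 by blast
  interpret Bk: brownian_motion M "Bs ! k" by (rule bm[OF k])
  have pair: "indep_set (past_events M (Bs ! k) s) ?I"
    by (rule Bk.past_indep_increment[OF st])
  have past_E: "past_events M (Bs ! i) s \<subseteq> ?E i" for i
    by (rule past_events_subset_process_events)
  have I_E: "?I \<subseteq> ?E k"
  proof safe
    fix A :: "real set" assume A: "A \<in> sets borel"
    let ?f = "\<lambda>x :: real \<Rightarrow> real. x t - x s"
    have "?f \<in> borel_measurable (Pi\<^sub>M {0..} (\<lambda>_. borel))"
      using st by (intro borel_measurable_diff measurable_component_singleton) auto
    from measurable_sets[OF this A] st
    show "\<exists>A'. ?D -` A \<inter> space M = (\<lambda>\<omega>. \<lambda>t\<in>{0..}. (Bs ! k) t \<omega>) -` A' \<inter> space M \<and>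
        A' \<in> sets (Pi\<^sub>M {0..} (\<lambda>_. borel))"
      by (intro exI[of _ "?f -` A \<inter> space (Pi\<^sub>M {0..} (\<lambda>_. borel))"])
        (auto simp: space_PiM)
  qed
  have E_events: "?E i \<subseteq> events" if "i < ?n" for i
    using E that unfolding indep_sets_def by blast
  have I_events: "?I \<subseteq> events" by (rule order_trans[OF I_E E_events[OF k]])
  have past_events': "past_events M (Bs ! i) s \<subseteq> events" if "i < ?n" for i
    by (rule order_trans[OF past_E E_events[OF that]])
  have sigma_past: "sigma_algebra (space M) (past_events M (Bs ! i) s)" for i
    unfolding past_events_def by (rule sigma_algebra_sigma_sets) auto
  have "indep_sets G {..?n}"
  proof (subst indep_sets_finite)
    show "G i \<subseteq> events" if "i \<in> {..?n}" for i
      using past_events' I_events unfolding G_def by auto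
    show "space M \<in> G i" for i
    proof (cases "i < ?n")
      case True
      then show ?thesis by (simp add: G_def past_events_def sigma_sets_top)
    next
      case False
      have "space M = ?D -` UNIV \<inter> space M" by simp
      then have "space M \<in> ?I" by (intro CollectI exI[of _ UNIV]) auto
      with False show ?thesis by (simp add: G_def)
    qed
    show "\<forall>A\<in>Pi {..?n} G. prob (\<Inter>j\<in>{..?n}. A j) = (\<Prod>j\<in>{..?n}. prob (A j))"
    proof
      fix A assume A: "A \<in> Pi {..?n} G"
      have past: "A i \<in> past_events M (Bs ! i) s" if "i < ?n" for i
        using Pi_mem[OF A, of i] that by (simp add: G_def)
      have An: "A ?n \<in> ?I" using Pi_mem[OF A, of ?n] by (simp add: G_def)
      \<comment> \<open>Merge the increment event into the event of its own process, so that only the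
        independence of the \<open>length Bs\<close> processes is needed.\<close>
      define A' where "A' i = (if i = k then A k \<inter> A ?n else A i)" for i
      have A': "A' i \<in> ?E i" if "i < ?n" for i
      proof (cases "i = k")
        case True
        have "A k \<in> ?E k" "A ?n \<in> ?E k" using past[OF k] past_E An I_E by blast+
        then have "A k \<inter> A ?n \<in> ?E k" by (rule Int_stableD[OF Int_stable_preimages])
        then show ?thesis using True by (simp add: A'_def)
      qed (use past[OF that] past_E in \<open>auto simp: A'_def\<close>)
      have "(\<Inter>j\<in>{..?n}. A j) = (\<Inter>j\<in>{..<?n}. A' j)"
        unfolding A'_def lessThan_Suc_atMost[symmetric] lessThan_Suc using k by
            (auto split: if_splits)
      also have "prob \<dots> = (\<Prod>j<?n. prob (A' j))"
        by (rule indep_setsD[OF E]) (use A' k in auto)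
      also have "\<dots> = prob (A' k) * (\<Prod>j\<in>{..<?n} - {k}. prob (A' j))"
        using k by (intro prod.remove) auto
      also have "(\<Prod>j\<in>{..<?n} - {k}. prob (A' j)) = (\<Prod>j\<in>{..<?n} - {k}. prob (A j))"
        by (intro prod.cong) (auto simp: A'_def)
      also have "prob (A' k) = prob (A k) * prob (A ?n)"
        using indep_setD[OF pair past[OF k] An] by (simp add: A'_def)
      also have "prob (A k) * prob (A ?n) * (\<Prod>j\<in>{..<?n} - {k}. prob (A j)) =
         (prob (A k) * (\<Prod>j\<in>{..<?n} - {k}. prob (A j))) * prob (A ?n)" by simp
      also have "prob (A k) * (\<Prod>j\<in>{..<?n} - {k}. prob (A j)) = (\<Prod>j<?n. prob (A j))"
        using k by (intro prod.remove[symmetric]) auto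
      also have "(\<Prod>j<?n. prob (A j)) * prob (A ?n) = (\<Prod>j\<in>{..?n}. prob (A j))"
        by (simp add: lessThan_Suc_atMost[symmetric] mult.commute)
      finally show "prob (\<Inter>j\<in>{..?n}. A j) = (\<Prod>j\<in>{..?n}. prob (A j))" .
    qed
  qed auto
  have coll: "indep_sets (\<lambda>b. sigma_sets (space M) (\<Union>i\<in>case_bool {..<?n} {?n} b. G i)) UNIV"
  proof (rule indep_sets_collect_sigma)
    have "(\<Union>j\<in>UNIV. case_bool {..<?n} {?n} j) = {..?n}" by (auto simp: UNIV_bool)
    then show "indep_sets G (\<Union>j\<in>UNIV. case_bool {..<?n} {?n} j)"
      using \<open>indep_sets G {..?n}\<close> by simp
    show "Int_stable (G i)" for i
    proof (cases "i < ?n")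
      case True
      interpret sigma_algebra "space M" "past_events M (Bs ! i) s" by (rule sigma_past)
      show ?thesis using True by (auto simp: G_def Int_stable_def)
    next
      case False
      then show ?thesis using Int_stable_preimages by (simp add: G_def)
    qed
    show "disjoint_family_on (case_bool {..<?n} {?n}) UNIV"
      by (auto simp: disjoint_family_on_def split: bool.splits)
  qed
  have nat_sets: "sets (natural_filtration M Bs s) \<subseteq> sigma_sets (space M) (\<Union>i\<in>{..<?n}. G i)"
  proof -
    let ?gen = "{B u -` A \<inter> space M | B u A. B \<in> set Bs \<and> 0 \<le> u \<and> u \<le> s \<and> A \<in> sets borel}"
    have "sets (natural_filtration M Bs s) = sigma_sets (space M) ?gen"
      unfolding natural_filtration_def by (rule sets_measure_of) auto
    also have "\<dots> \<subseteq> sigma_sets (space M) (\<Union>i\<in>{..<?n}. G i)"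
    proof (rule sigma_sets_mono', safe)
      fix B :: "real \<Rightarrow> 'a \<Rightarrow> real" and u :: real and A :: "real set" assume B: "B \<in> set Bs" "0
          \<le> u" "u \<le> s" "A \<in> sets borel"
      then obtain i where i: "i < ?n" "B = Bs ! i" by (metis in_set_conv_nth)
      then have "B u -` A \<inter> space M \<in> G i"
        unfolding G_def past_events_def using B by (auto intro!: sigma_sets.Basic)
      then show "B u -` A \<inter> space M \<in> (\<Union>i\<in>{..<?n}. G i)" using i by blast
    qed
    finally show ?thesis .
  qed
  show ?thesis unfolding indep_set_def
  proof (rule indep_sets_mono_sets[OF coll])
    fix b :: bool
    show "(case b of True \<Rightarrow> sets (natural_filtration M Bs s) | False \<Rightarrow> sigma_sets (space M) ?I)
       \<subseteq> sigma_sets (space M) (\<Union>i\<in>case_bool {..<?n} {?n} b. G i)"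
      using nat_sets by (cases b) (simp_all add: G_def)
  qed
qed

lemma (in prob_space) filtered_brownian_motion_natural_filtration:
  assumes ind: "indep_processes Bs" and bm: "\<And>i. i < length Bs \<Longrightarrow> brownian_motion M (Bs ! i)"
    and k: "k < length Bs"
  shows "filtered_brownian_motion M (Bs ! k) (natural_filtration M Bs)"
proof -
  interpret Bk: brownian_motion M "Bs ! k" by (rule bm[OF k])
  let ?F = "natural_filtration M Bs"
  let ?gen = "\<lambda>s. {B u -` A \<inter> space M | B u A. B \<in> set Bs \<and> 0 \<le> u \<and> u \<le> s \<and> A \<in> sets borel}"
  have sets_F: "sets (?F s) = sigma_sets (space M) (?gen s)" for s
    unfolding natural_filtration_def by (rule sets_measure_of) auto
  have space_F: "space (?F s) = space M" for s
    unfolding natural_filtration_def by (rule space_measure_of) auto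
  have sub: "subalgebra M (?F s)" for s
    unfolding subalgebra_def sets_F space_F
  proof (intro conjI refl sets.sigma_sets_subset, safe)
    fix B :: "real \<Rightarrow> 'a \<Rightarrow> real" and u :: real and A :: "real set" assume B: "B \<in> set Bs" "0
        \<le> u" "A \<in> sets borel"
    then obtain i where i: "i < length Bs" "B = Bs ! i" by (metis in_set_conv_nth)
    show "B u -` A \<inter> space M \<in> events"
      using brownian_motion.measurable_at[OF bm[OF i(1)] B(2)] B(3) i(2) by
          (simp add: measurable_sets)
  qed
  show ?thesis
  proof (unfold_locales)
    show "subalgebra M (?F s)" for s by (rule sub)
    show "subalgebra (?F t) (?F s)" if "s \<le> t" for s t
      unfolding subalgebra_def sets_F space_F using that
      by (intro conjI refl sigma_sets_mono') (auto, metis order_trans)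
    show "(Bs ! k) t \<in> borel_measurable (?F t)" if "0 \<le> t" for t
    proof (rule measurableI)
      fix A :: "real set" assume "A \<in> sets borel"
      then show "(Bs ! k) t -` A \<inter> space (?F t) \<in> sets (?F t)"
        unfolding sets_F space_F using that k nth_mem[OF k] by (intro sigma_sets.Basic) blast
    qed simp
    show "indep_var borel g borel (\<lambda>\<omega>. (Bs ! k) t \<omega> - (Bs ! k) s \<omega>)"
      if st: "0 \<le> s" "s \<le> t" and g: "g \<in> borel_measurable (?F s)" for s t g
      unfolding indep_var_eq
    proof (intro conjI)
      show "random_variable borel g" by (rule measurable_from_subalg[OF sub g])
      show "random_variable borel (\<lambda>\<omega>. (Bs ! k) t \<omega> - (Bs ! k) s \<omega>)"
        using st by (intro borel_measurable_diff Bk.measurable_at) auto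
      have "sigma_sets (space M) {g -` A \<inter> space M | A. A \<in> sets borel} \<subseteq> sets (?F s)"
        unfolding space_F[of s, symmetric]
        by (rule sets.sigma_sets_subset) (use measurable_sets[OF g] in auto)
      then show "indep_set (sigma_sets (space M) {g -` A \<inter> space M | A. A \<in> sets borel})
        (sigma_sets (space M) {(\<lambda>\<omega>. (Bs ! k) t \<omega> - (Bs ! k) s \<omega>) -` A \<inter> space M | A. A \<in> sets borel})"
        unfolding indep_set_def
        by (intro indep_sets_mono_sets[OF independent_past_and_increment[OF ind _ k st,
              unfolded indep_set_def]] bm) (simp_all split: bool.splits)
    qed
  qed
qed

section \<open>Stochastic integrals of simple processes\<close>

lemma min_increment:
  fixes f :: "real \<Rightarrow> real"
  assumes "s \<le> t" "u \<le> s \<or> t \<le> u"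
  shows "f (min t u) - f (min s u) = (if u \<le> s then 0 else f t - f s)"
  using assms by (auto simp: min_def)

text \<open>
  If no jump time of the process lies strictly between \<open>s\<close> and \<open>t\<close>, then on \<open>{s<..t}\<close> the process is
  a single random variable that is known at time \<open>s\<close>, and its integral grows by that variable times
  the increment of \<open>B\<close>.
\<close>
lemma simple_process_on_grid:
  assumes S: "is_simple_process M F (n, \<tau>, \<xi>)" and "s \<le> t"
    and free: "\<And>i. i \<le> n \<Longrightarrow> \<tau> i \<le> s \<or> t \<le> \<tau> i"
  defines "\<eta> \<equiv> \<lambda>\<omega>. \<Sum>i<n. (if \<tau> i \<le> s \<and> s < \<tau> (Suc i) then \<xi> i \<omega> else 0)"
  shows "simple_integral_wrt B (n, \<tau>, \<xi>) t \<omega> =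
       simple_integral_wrt B (n, \<tau>, \<xi>) s \<omega> + \<eta> \<omega> * (B t \<omega> - B s \<omega>)"
    and "s < u \<Longrightarrow> u \<le> t \<Longrightarrow> simple_value (n, \<tau>, \<xi>) u \<omega> = \<eta> \<omega>"
proof -
  have inc: "\<tau> i < \<tau> (Suc i)" if "i < n" for i
    using S that by (auto simp: is_simple_process_def)
  have "simple_integral_wrt B (n, \<tau>, \<xi>) t \<omega> - simple_integral_wrt B (n, \<tau>, \<xi>) s \<omega> =
     (\<Sum>i<n. \<xi> i \<omega> * ((B (min t (\<tau> (Suc i))) \<omega> - B (min s (\<tau> (Suc i))) \<omega>)
       - (B (min t (\<tau> i)) \<omega> - B (min s (\<tau> i)) \<omega>)))"
    by (simp add: simple_integral_wrt_def sum_subtractf[symmetric] algebra_simps)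
  also have "\<dots> = (\<Sum>i<n. (if \<tau> i \<le> s \<and> s < \<tau> (Suc i) then \<xi> i \<omega> else 0) * (B t \<omega> - B s \<omega>))"
  proof (intro sum.cong refl)
    fix i assume "i \<in> {..<n}"
    then have i: "i < n" by simp
    have "B (min t (\<tau> (Suc i))) \<omega> - B (min s (\<tau> (Suc i))) \<omega> = (if \<tau> (Suc i)
        \<le> s then 0 else B t \<omega> - B s \<omega>)"
      "B (min t (\<tau> i)) \<omega> - B (min s (\<tau> i)) \<omega> = (if \<tau> i \<le> s then 0 else B t \<omega> - B s \<omega>)"
      using min_increment[OF \<open>s \<le> t\<close> free, of "Suc i" "\<lambda>t. B t \<omega>"] min_increment[OF \<open>s
          \<le> t\<close> free, of i "\<lambda>t. B t \<omega>"] i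
      by auto
    then show "\<xi> i \<omega> * ((B (min t (\<tau> (Suc i))) \<omega> - B (min s (\<tau> (Suc i))) \<omega>)
       - (B (min t (\<tau> i)) \<omega> - B (min s (\<tau> i)) \<omega>)) =
       (if \<tau> i \<le> s \<and> s < \<tau> (Suc i) then \<xi> i \<omega> else 0) * (B t \<omega> - B s \<omega>)"
      using inc[OF i] by auto
  qed
  also have "\<dots> = \<eta> \<omega> * (B t \<omega> - B s \<omega>)" by (simp add: \<eta>_def sum_distrib_right)
  finally show "simple_integral_wrt B (n, \<tau>, \<xi>) t \<omega> =
       simple_integral_wrt B (n, \<tau>, \<xi>) s \<omega> + \<eta> \<omega> * (B t \<omega> - B s \<omega>)" by simp
  show "simple_value (n, \<tau>, \<xi>) u \<omega> = \<eta> \<omega>" if u: "s < u" "u \<le> t"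
    unfolding simple_value_def \<eta>_def prod.case
  proof (intro sum.cong refl)
    fix i assume "i \<in> {..<n}"
    then have "u \<in> {\<tau> i<..\<tau> (Suc i)} \<longleftrightarrow> \<tau> i \<le> s \<and> s < \<tau> (Suc i)"
      using free[of i] free[of "Suc i"] u by auto
    then show "\<xi> i \<omega> * indicator {\<tau> i<..\<tau> (Suc i)} u = (if \<tau> i
        \<le> s \<and> s < \<tau> (Suc i) then \<xi> i \<omega> else 0)"
      by (auto simp: indicator_def)
  qed
qed

text \<open>
  Half-open intervals make consecutive grid cells disjoint, so the sum telescopes.
\<close>
lemma sum_indicator_grid:
  fixes \<sigma> :: "nat \<Rightarrow> real"
  assumes "mono \<sigma>"
  shows "(\<Sum>l<m. indicator {\<sigma> l<..\<sigma> (Suc l)} s) = (indicator {\<sigma> 0<..\<sigma> m} s :: ennreal)"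
proof (induction m)
  case (Suc m)
  have "\<sigma> 0 \<le> \<sigma> m" "\<sigma> m \<le> \<sigma> (Suc m)" using assms by (auto intro: monoD)
  then show ?case using Suc by (auto simp: indicator_def)
qed simp

lemma grid_energy_le:
  fixes \<sigma> :: "nat \<Rightarrow> real" and c :: "nat \<Rightarrow> real"
  assumes mono: "mono \<sigma>" and bounds: "\<sigma> 0 = 0" "\<sigma> m = T"
    and f: "\<And>l u. l < m \<Longrightarrow> \<sigma> l < u \<Longrightarrow> u \<le> \<sigma> (Suc l) \<Longrightarrow> f u = c l"
  shows "ennreal (\<Sum>l<m. (\<sigma> (Suc l) - \<sigma> l) * (c l)\<^sup>2) \<le> (\<integral>\<^sup>+ s\<in>{0..T}. ennreal ((f s)\<^sup>2) \<partial>lborel)"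
proof -
  have le: "\<sigma> l \<le> \<sigma> (Suc l)" for l using mono by (auto intro: monoD)
  have "ennreal (\<Sum>l<m. (\<sigma> (Suc l) - \<sigma> l) * (c l)\<^sup>2)
      = (\<Sum>l<m. ennreal ((c l)\<^sup>2) * ennreal (\<sigma> (Suc l) - \<sigma> l))"
    using le by (subst sum_ennreal[symmetric]) (auto simp: ennreal_mult[symmetric] mult.commute)
  also have "\<dots> = (\<Sum>l<m. \<integral>\<^sup>+ s. ennreal ((c l)\<^sup>2) * indicator {\<sigma> l<..\<sigma> (Suc l)} s \<partial>lborel)"
    by (intro sum.cong refl, subst nn_integral_cmult_indicator) (auto simp: le)
  also have "\<dots> = (\<integral>\<^sup>+ s. (\<Sum>l<m. ennreal ((c l)\<^sup>2) * indicator {\<sigma> l<..\<sigma> (Suc l)} s) \<partial>lborel)"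
    by (rule nn_integral_sum[symmetric]) auto
  also have "\<dots> \<le> (\<integral>\<^sup>+ s\<in>{0..T}. ennreal ((f s)\<^sup>2) \<partial>lborel)"
  proof (rule nn_integral_mono)
    fix s
    have "(\<Sum>l<m. ennreal ((c l)\<^sup>2) * indicator {\<sigma> l<..\<sigma> (Suc l)} s) =
       (\<Sum>l<m. ennreal ((f s)\<^sup>2) * indicator {\<sigma> l<..\<sigma> (Suc l)} s)"
      using f by (intro sum.cong refl) (auto simp: indicator_def)
    also have "\<dots> = ennreal ((f s)\<^sup>2) * indicator {0<..T} s"
      by (simp add: sum_distrib_left[symmetric] sum_indicator_grid[OF mono] bounds)
    also have "\<dots> \<le> ennreal ((f s)\<^sup>2) * indicator {0..T} s"
      by (auto simp: indicator_def)
    finally show "(\<Sum>l<m. ennreal ((c l)\<^sup>2) * indicator {\<sigma> l<..\<sigma> (Suc l)} s) \<le>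
      ennreal ((f s)\<^sup>2) * indicator {0..T} s" .
  qed
  finally show ?thesis .
qed

context filtered_brownian_motion
begin

text \<open>
  Refining the jump times by the times in \<open>J\<close> turns the values of the integral at those times into
  values of a discrete martingale transform. The event \<open>N\<close> expresses the energy as a finite sum, so
  it is measurable by construction.
\<close>
lemma simple_integral_maximal_inequality:
  assumes S: "is_simple_process M F S" and "0 \<le> T" and J: "finite J" "J \<subseteq> {0..T}"
    and "0 < r" "0 \<le> \<delta>"
  shows "\<exists>N \<in> events. {\<omega> \<in> space M. (\<exists>t\<in>J. r \<le> \<bar>simple_integral_wrt B S t \<omega>\<bar>) \<and>
       (\<integral>\<^sup>+ s\<in>{0..T}. ennreal ((simple_value S s \<omega>)\<^sup>2) \<partial>lborel) \<le> ennreal \<delta>} \<subseteq> N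
     \<and> prob N \<le> \<delta> / r\<^sup>2"
proof -
  obtain n \<tau> \<xi> where S_eq: "S = (n, \<tau>, \<xi>)" by (metis prod_cases3)
  have \<tau>0: "0 \<le> \<tau> 0" and \<tau>_inc: "\<And>i. i < n \<Longrightarrow> \<tau> i < \<tau> (Suc i)"
    and \<xi>_adapted: "\<And>i. i < n \<Longrightarrow> \<xi> i \<in> borel_measurable (F (\<tau> i))"
    and \<xi>_bounded: "\<And>i. i < n \<Longrightarrow> bounded (\<xi> i ` space M)"
    using S unfolding S_eq is_simple_process_def by auto
  have \<tau>_nonneg: "0 \<le> \<tau> i" if "i \<le> n" for i
    using that
  proof (induction i)
    case (Suc i)
    then show ?case using \<tau>_inc[of i] by simp
  qed (use \<tau>0 in simp)
  define K where "K = insert 0 (insert T (J \<union> (\<tau> ` {..n} \<inter> {0..T})))"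
  have K: "finite K" "0 \<in> K" "T \<in> K" "K \<subseteq> {0..T}" using J \<open>0 \<le> T\<close> by (auto simp: K_def)
  obtain \<sigma> m where "is_grid K 0 T \<sigma> m" using finite_grid[OF K] by blast
  then have \<sigma>: "\<sigma> 0 = 0" "\<sigma> m = T" "mono \<sigma>" "\<forall>i. \<sigma> i \<in> {0..T}" "\<sigma> ` {..m} = K"
    by (simp_all add: is_grid_def)
  have \<sigma>_le: "\<sigma> l \<le> \<sigma> (Suc l)" and \<sigma>_nonneg: "0 \<le> \<sigma> l" for l
    using \<sigma>(4) monoD[OF \<sigma>(3), of l "Suc l"] by auto
  have free: "\<tau> i \<le> \<sigma> l \<or> \<sigma> (Suc l) \<le> \<tau> i" if "i \<le> n" for i l
  proof (cases "\<tau> i \<le> T")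
    case True
    then have "\<tau> i \<in> \<sigma> ` {..m}" unfolding \<sigma>(5) K_def using \<tau>_nonneg[OF that] that by simp
    then obtain k where "\<tau> i = \<sigma> k" by blast
    moreover have "k \<le> l \<or> Suc l \<le> k" by linarith
    ultimately show ?thesis using monoD[OF \<sigma>(3)] by metis
  next
    case False
    then show ?thesis using \<sigma>(4)
        by (meson atLeastAtMost_iff linorder_not_le order_trans order.strict_implies_order)
  qed
  define \<eta> where "\<eta> l \<omega> = (\<Sum>i<n. if \<tau> i \<le> \<sigma> l \<and> \<sigma> l < \<tau> (Suc i) then \<xi> i \<omega> else 0)" for l \<omega>
  define D where "D l \<omega> = B (\<sigma> (Suc l)) \<omega> - B (\<sigma> l) \<omega>" for l \<omega>
  define v where "v l = \<sigma> (Suc l) - \<sigma> l" for l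
  have \<eta>_adapted: "\<eta> l \<in> borel_measurable (F (\<sigma> l))" for l
    unfolding \<eta>_def
  proof (intro borel_measurable_sum)
    fix i assume "i \<in> {..<n}"
    then show "(\<lambda>\<omega>. if \<tau> i \<le> \<sigma> l \<and> \<sigma> l < \<tau> (Suc i) then \<xi> i \<omega> else 0) \<in> borel_measurable (F (\<sigma> l))"
      using measurable_from_subalg[OF filtration_mono \<xi>_adapted, of i "\<sigma> l"] \<tau>_nonneg[of i]
      by (cases "\<tau> i \<le> \<sigma> l"; cases "\<sigma> l < \<tau> (Suc i)") simp_all
  qed
  have \<eta>_bounded: "bounded (\<eta> l ` space M)" for l
  proof -
    have "\<forall>i. \<exists>C. i < n \<longrightarrow> (\<forall>\<omega>\<in>space M. \<bar>\<xi> i \<omega>\<bar> \<le> C)"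
      using \<xi>_bounded by (auto simp: bounded_iff)
    then obtain C where C: "\<And>i \<omega>. i < n \<Longrightarrow> \<omega> \<in> space M \<Longrightarrow> \<bar>\<xi> i \<omega>\<bar> \<le> C i" by metis
    have "\<bar>\<eta> l \<omega>\<bar> \<le> (\<Sum>i<n. \<bar>C i\<bar>)" if "\<omega> \<in> space M" for \<omega>
      unfolding \<eta>_def
    proof (rule order_trans[OF sum_abs sum_mono])
      fix i assume "i \<in> {..<n}"
      then show "\<bar>if \<tau> i \<le> \<sigma> l \<and> \<sigma> l < \<tau> (Suc i) then \<xi> i \<omega> else 0\<bar> \<le> \<bar>C i\<bar>"
        using C[of i \<omega>] that by auto
    qed
    then show ?thesis by (auto simp: bounded_iff)
  qed
  have integral_eq: "simple_integral_wrt B S (\<sigma> j) \<omega> = (\<Sum>l<j. \<eta> l \<omega> * D l \<omega>)" for j \<omega>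
  proof (induction j)
    case 0
    have "simple_integral_wrt B S 0 \<omega> = 0"
      unfolding S_eq simple_integral_wrt_def prod.case using \<tau>_nonneg
      by (intro sum.neutral) (auto simp: min_def)
    then show ?case by (simp add: \<sigma>)
  next
    case (Suc j)
    have "simple_integral_wrt B S (\<sigma> (Suc j)) \<omega> = simple_integral_wrt B S (\<sigma> j) \<omega> + \<eta> j \<omega> * D j \<omega>"
      unfolding S_eq \<eta>_def D_def
      by (rule simple_process_on_grid(1)[OF S[unfolded S_eq] \<sigma>_le free])
    then show ?case using Suc by simp
  qed
  have energy: "ennreal (\<Sum>l<m. v l * (\<eta> l \<omega>)\<^sup>2) \<le> (\<integral>\<^sup>+ s\<in>{0..T}. ennreal ((simple_value S s \<omega>)\<^sup>2)
      \<partial>lborel)" for \<omega>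
    unfolding v_def
  proof (rule grid_energy_le[OF \<sigma>(3,1,2)])
    show "simple_value S u \<omega> = \<eta> l \<omega>" if "\<sigma> l < u" "u \<le> \<sigma> (Suc l)" for l u
      unfolding S_eq \<eta>_def by (rule simple_process_on_grid(2)[OF S[unfolded S_eq] \<sigma>_le free that])
  qed
  have D_eq: "D l = (\<lambda>\<omega>. B (\<sigma> (Suc l)) \<omega> - B (\<sigma> l) \<omega>)" for l by (simp add: D_def[abs_def])
  have D_adapted: "D l \<in> borel_measurable (F (\<sigma> (Suc l)))" for l
    unfolding D_eq
    by (intro borel_measurable_diff adapted \<sigma>_nonneg measurable_from_subalg[OF filtration_mono adapted] \<sigma>_le)
  let ?N = "{\<omega> \<in> space M. (\<exists>j\<le>m. r \<le> \<bar>\<Sum>l<j. \<eta> l \<omega> * D l \<omega>\<bar>) \<and> (\<Sum>l<m. v l * (\<eta> l \<omega>)\<^sup>2) \<le> \<delta>}"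
  have [measurable]: "\<eta> l \<in> borel_measurable M" "D l \<in> borel_measurable M" for l
    by (rule measurable_from_subalg[OF filtration_sub \<eta>_adapted] measurable_from_subalg[OF filtration_sub D_adapted];
        rule \<sigma>_nonneg)+
  have "?N \<in> events" by measurable
  moreover have "prob ?N \<le> \<delta> / r\<^sup>2"
  proof (rule martingale_transform_maximal_inequality[where G="\<lambda>l. F (\<sigma> l)"])
    show "indep_var borel g borel (D j)" if "g \<in> borel_measurable (F (\<sigma> j))" for j g
      unfolding D_eq by (rule increment_indep[OF \<sigma>_nonneg \<sigma>_le that])
    show "integrable M (D j)" "expectation (D j) = 0" "integrable M (\<lambda>\<omega>. (D j \<omega>)\<^sup>2)"
      "expectation (\<lambda>\<omega>. (D j \<omega>)\<^sup>2) = v j" for j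
      unfolding D_eq v_def by (rule increment_moments[OF \<sigma>_nonneg \<sigma>_le])+
    show "0 \<le> v j" for j by (simp add: v_def \<sigma>_le)
  qed (simp_all add: filtration_sub filtration_mono \<sigma>_nonneg \<sigma>_le D_adapted \<eta>_adapted \<eta>_bounded \<open>0 < r\<close> \<open>0 \<le> \<delta>\<close>)
  moreover have "{\<omega> \<in> space M. (\<exists>t\<in>J. r \<le> \<bar>simple_integral_wrt B S t \<omega>\<bar>) \<and>
       (\<integral>\<^sup>+ s\<in>{0..T}. ennreal ((simple_value S s \<omega>)\<^sup>2) \<partial>lborel) \<le> ennreal \<delta>} \<subseteq> ?N"
  proof safe
    fix \<omega> t assume t: "t \<in> J" "r \<le> \<bar>simple_integral_wrt B S t \<omega>\<bar>"
      and le: "(\<integral>\<^sup>+ s\<in>{0..T}. ennreal ((simple_value S s \<omega>)\<^sup>2) \<partial>lborel) \<le> ennreal \<delta>"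
    have "t \<in> \<sigma> ` {..m}" unfolding \<sigma>(5) K_def using t by simp
    then obtain j where "j \<le> m" "t = \<sigma> j" by auto
    then show "\<exists>j\<le>m. r \<le> \<bar>\<Sum>l<j. \<eta> l \<omega> * D l \<omega>\<bar>" using t integral_eq by auto
    from order_trans[OF energy le] show "(\<Sum>l<m. v l * (\<eta> l \<omega>)\<^sup>2) \<le> \<delta>"
      using \<open>0 \<le> \<delta>\<close> by (simp add: ennreal_le_iff)
  qed
  ultimately show ?thesis by blast
qed

end

section \<open>A maximal inequality for Ito integrals\<close>

lemma null_in_probabilityD:
  "null_in_probability M D \<Longrightarrow> 0 < \<epsilon> \<Longrightarrow>
     (\<lambda>k. emeasure M {\<omega> \<in> space M. \<epsilon> \<le> D k \<omega>}) \<longlonglongrightarrow> 0"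
  by (simp add: null_in_probability_def)

text \<open>
  Progressive measurability is joint measurability in time and outcome, so both claims are instances
  of the measurability of sections and of Fubini's theorem.
\<close>
lemma
  assumes H: "progressively_measurable F H" and "0 \<le> T" and sub: "subalgebra M (F T)"
  shows progressive_energy_measurable:
      "(\<lambda>\<omega>. \<integral>\<^sup>+ s\<in>{0..T}. ennreal ((H s \<omega>)\<^sup>2) \<partial>lborel) \<in> borel_measurable M"
    and progressive_path_measurable:
      "\<omega> \<in> space M \<Longrightarrow> (\<lambda>s. H s \<omega> * indicator {0..T} s) \<in> borel_measurable lborel"
proof -
  have H': "(\<lambda>(s, \<omega>). H s \<omega>) \<in> borel_measurable (restrict_space borel {0..T} \<Otimes>\<^sub>M F T)"
    using H \<open>0 \<le> T\<close> by (auto simp: progressively_measurable_def)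
  have sp: "space (F T) = space M" using sub by (simp add: subalgebra_def)
  have cong: "sets (F T \<Otimes>\<^sub>M restrict_space lborel {0..T})
      = sets (F T \<Otimes>\<^sub>M restrict_space borel {0..T})"
    by (intro sets_pair_measure_cong refl sets_restrict_space_cong) simp
  have "(\<lambda>x. (\<lambda>(s, \<omega>). H s \<omega>) (snd x, fst x)) \<in> borel_measurable (F T \<Otimes>\<^sub>M restrict_space borel {0..T})"
    by (rule measurable_compose[OF _ H']) measurable
  then have swap: "(\<lambda>x. ennreal ((H (snd x) (fst x))\<^sup>2)) \<in> borel_measurable (F T \<Otimes>\<^sub>M restrict_space lborel {0..T})"
    by (subst measurable_cong_sets[OF cong refl]) (auto intro: borel_measurable_power)
  interpret R: sigma_finite_measure "restrict_space lborel {0..T}"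
    by (rule sigma_finite_measure_restrict_space) (auto intro: lborel.sigma_finite_measure_axioms)
  have "(\<lambda>\<omega>. \<integral>\<^sup>+ s. ennreal ((H s \<omega>)\<^sup>2) \<partial>restrict_space lborel {0..T}) \<in> borel_measurable (F T)"
    by (rule R.borel_measurable_nn_integral) (use swap in \<open>simp add: case_prod_beta'\<close>)
  then have "(\<lambda>\<omega>. \<integral>\<^sup>+ s\<in>{0..T}. ennreal ((H s \<omega>)\<^sup>2) \<partial>lborel) \<in> borel_measurable (F T)"
    by (simp add: nn_integral_restrict_space)
  then show "(\<lambda>\<omega>. \<integral>\<^sup>+ s\<in>{0..T}. ennreal ((H s \<omega>)\<^sup>2) \<partial>lborel) \<in> borel_measurable M"
    by (rule measurable_from_subalg[OF sub])
  assume \<omega>: "\<omega> \<in> space M"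
  have "(\<lambda>s. (\<lambda>(s, \<omega>). H s \<omega>) (s, \<omega>)) \<in> borel_measurable (restrict_space borel {0..T})"
    by (rule measurable_compose[OF _ H'], rule measurable_Pair2') (simp add: sp \<omega>)
  then have "(\<lambda>s. H s \<omega>) \<in> borel_measurable (restrict_space borel {0..T})" by simp
  then show "(\<lambda>s. H s \<omega> * indicator {0..T} s) \<in> borel_measurable lborel"
    by (subst (asm) borel_measurable_restrict_space_iff) (auto simp: mult.commute)
qed

lemma energy_triangle:
  fixes f g :: "real \<Rightarrow> real"
  assumes f: "(\<lambda>s. f s * indicator A s) \<in> borel_measurable lborel"
    and g: "(\<lambda>s. g s * indicator A s) \<in> borel_measurable lborel"
  shows "(\<integral>\<^sup>+ s\<in>A. ennreal ((f s)\<^sup>2) \<partial>lborel) \<le>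
    2 * (\<integral>\<^sup>+ s\<in>A. ennreal ((f s - g s)\<^sup>2) \<partial>lborel) + 2 * (\<integral>\<^sup>+ s\<in>A. ennreal ((g s)\<^sup>2) \<partial>lborel)"
proof -
  have eq: "(\<integral>\<^sup>+ s\<in>A. ennreal ((h s)\<^sup>2) \<partial>lborel) = (\<integral>\<^sup>+ s. ennreal ((h s * indicator A s)\<^sup>2)
      \<partial>lborel)"
    for h :: "real \<Rightarrow> real"
    by (intro nn_integral_cong) (auto simp: indicator_def)
  have "(\<integral>\<^sup>+ s. ennreal ((f s * indicator A s)\<^sup>2) \<partial>lborel) \<le>
    (\<integral>\<^sup>+ s. 2 * ennreal ((f s * indicator A s - g s * indicator A s)\<^sup>2)
        + 2 * ennreal ((g s * indicator A s)\<^sup>2) \<partial>lborel)"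
  proof (rule nn_integral_mono)
    fix s
    let ?f = "f s * indicator A s" and ?g = "g s * indicator A s"
    have "2 * (?f - ?g)\<^sup>2 + 2 * ?g\<^sup>2 - ?f\<^sup>2 = (?f - 2 * ?g)\<^sup>2"
      by (simp add: power2_eq_square algebra_simps)
    then have "?f\<^sup>2 \<le> 2 * (?f - ?g)\<^sup>2 + 2 * ?g\<^sup>2"
      using zero_le_power2[of "?f - 2 * ?g"] by linarith
    then have "ennreal (?f\<^sup>2) \<le> ennreal (2 * (?f - ?g)\<^sup>2 + 2 * ?g\<^sup>2)" by (rule ennreal_leI)
    also have "\<dots> = 2 * ennreal ((?f - ?g)\<^sup>2) + 2 * ennreal (?g\<^sup>2)"
      by (simp add: ennreal_plus ennreal_mult)
    finally show "ennreal (?f\<^sup>2) \<le> 2 * ennreal ((?f - ?g)\<^sup>2) + 2 * ennreal (?g\<^sup>2)" .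
  qed
  also have "\<dots> = 2 * (\<integral>\<^sup>+ s. ennreal ((f s * indicator A s - g s * indicator A s)\<^sup>2) \<partial>lborel) +
      2 * (\<integral>\<^sup>+ s. ennreal ((g s * indicator A s)\<^sup>2) \<partial>lborel)"
    using f g by (subst nn_integral_add) (auto simp: nn_integral_cmult)
  finally show ?thesis by (simp add: eq left_diff_distrib)
qed

lemma simple_value_measurable: "(\<lambda>s. simple_value S s \<omega>) \<in> borel_measurable lborel"
  unfolding simple_value_def case_prod_beta
  by (intro borel_measurable_sum borel_measurable_times borel_measurable_indicator) auto

lemma bounded_on_rationals_imp_bounded:
  fixes f :: "real \<Rightarrow> real"
  assumes f: "continuous_on {0..} f" and "0 < T" and le: "\<And>t. t \<in> {0..T} \<inter> \<rat> \<Longrightarrow> \<bar>f t\<bar> \<le> r"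
    and t: "t \<in> {0..T}"
  shows "\<bar>f t\<bar> \<le> r"
proof -
  let ?S = "{0<..<T} \<inter> (\<rat> :: real set)"
  have "closure ?S = closure {0<..<T}"
    by (rule closure_open_Int_superset) (auto simp: Rats_closure_real)
  then have cl: "closure ?S = {0..T}" using \<open>0 < T\<close> by simp
  show ?thesis
  proof (rule continuous_le_on_closure[of ?S "\<lambda>t. \<bar>f t\<bar>"])
    show "continuous_on (closure ?S) (\<lambda>t. \<bar>f t\<bar>)"
      unfolding cl by (intro continuous_intros continuous_on_subset[OF f]) auto
  qed (use t cl le in auto)
qed

context filtered_brownian_motion
begin

text \<open>
  For an approximating simple process \<open>S k\<close>, the event forces one of three things: the energy of
  \<open>S k - H\<close> is at least \<open>\<delta>\<close>; at some time in \<open>J\<close> the integral of \<open>S k\<close> differs from \<open>I\<close> by at least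
  \<open>r / 2\<close>; or the integral of \<open>S k\<close> reaches \<open>r / 2\<close> while its energy is at most
  \<open>2 * \<delta> + 2 * \<delta>\<close>. The first two have vanishing probability as \<open>k\<close> grows, and the third has
  probability at most \<open>4 * \<delta> / (r / 2)\<^sup>2\<close> by the inequality for simple processes.
\<close>
lemma ito_maximal_inequality_finite:
  assumes I: "has_ito_integral M F B H I" and "0 \<le> T" and J: "finite J" "J \<subseteq> {0..T}"
    and "0 < r" "0 < \<delta>"
  shows "emeasure M {\<omega> \<in> space M. (\<exists>t\<in>J. r < \<bar>I t \<omega>\<bar>) \<and>
     (\<integral>\<^sup>+ s\<in>{0..T}. ennreal ((H s \<omega>)\<^sup>2) \<partial>lborel) < ennreal \<delta>} \<le> ennreal (16 * \<delta> / r\<^sup>2)"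
    (is "emeasure M ?E \<le> _")
proof -
  have H: "progressively_measurable F H" using I by (simp add: has_ito_integral_def)
  from I obtain S where S: "\<forall>k. is_simple_process M F (S k)"
    and S_H': "\<forall>T\<ge>0. null_in_probability M
        (\<lambda>k \<omega>. \<integral>\<^sup>+ s\<in>{0..T}. ennreal ((simple_value (S k) s \<omega> - H s \<omega>)\<^sup>2) \<partial>lborel)"
    and S_I': "\<forall>t\<ge>0. null_in_probability M
        (\<lambda>k \<omega>. ennreal \<bar>simple_integral_wrt B (S k) t \<omega> - I t \<omega>\<bar>)"
    unfolding has_ito_integral_def by (elim conjE exE)
  have S_H: "null_in_probability M
      (\<lambda>k \<omega>. \<integral>\<^sup>+ s\<in>{0..T}. ennreal ((simple_value (S k) s \<omega> - H s \<omega>)\<^sup>2) \<partial>lborel)"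
    using S_H' \<open>0 \<le> T\<close> by blast
  have S_I: "null_in_probability M (\<lambda>k \<omega>. ennreal \<bar>simple_integral_wrt B (S k) t \<omega> - I t \<omega>\<bar>)"
      if "t \<in> J" for t
    using S_I' J(2) that by auto
  define D where "D k \<omega> = (\<integral>\<^sup>+ s\<in>{0..T}. ennreal ((simple_value (S k) s \<omega> - H s \<omega>)\<^sup>2) \<partial>lborel)"
      for k \<omega>
  define R where "R t k \<omega> = ennreal \<bar>simple_integral_wrt B (S k) t \<omega> - I t \<omega>\<bar>" for t k \<omega>
  define e where "e k = ennreal (16 * \<delta> / r\<^sup>2) + ((\<Sum>t\<in>J. emeasure M {\<omega> \<in> space M. ennreal (r / 2)
      \<le> R t k \<omega>})
     + emeasure M {\<omega> \<in> space M. ennreal \<delta> \<le> D k \<omega>})" for k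
  have [measurable]: "D k \<in> borel_measurable M" for k
    using S_H unfolding null_in_probability_def D_def[abs_def] by blast
  have R_meas: "R t k \<in> borel_measurable M" if "t \<in> J" for t k
    using S_I[OF that] unfolding null_in_probability_def R_def[abs_def] by blast
  have bound: "emeasure M ?E \<le> e k" for k
  proof -
    obtain N where N: "N \<in> events"
      "{\<omega> \<in> space M. (\<exists>t\<in>J. r / 2 \<le> \<bar>simple_integral_wrt B (S k) t \<omega>\<bar>) \<and>
       (\<integral>\<^sup>+ s\<in>{0..T}. ennreal ((simple_value (S k) s \<omega>)\<^sup>2) \<partial>lborel) \<le> ennreal (4 * \<delta>)} \<subseteq> N"
      "prob N \<le> 4 * \<delta> / (r / 2)\<^sup>2"
      using simple_integral_maximal_inequality[OF S[rule_format] \<open>0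
          \<le> T\<close> J, of "r / 2" "4 * \<delta>" k] \<open>0 < r\<close> \<open>0 < \<delta>\<close> by auto
    have "?E \<subseteq> N \<union> ((\<Union>t\<in>J. {\<omega> \<in> space M. ennreal (r / 2) \<le> R t k \<omega>}) \<union> {\<omega> \<in> space M. ennreal \<delta>
        \<le> D k \<omega>})"
    proof (rule subsetI, rule ccontr)
      fix \<omega> assume "\<omega> \<in> ?E"
      then obtain t where \<omega>: "\<omega> \<in> space M" "t \<in> J" "r < \<bar>I t \<omega>\<bar>"
        "(\<integral>\<^sup>+ s\<in>{0..T}. ennreal ((H s \<omega>)\<^sup>2) \<partial>lborel) < ennreal \<delta>" by auto
      assume "\<omega> \<notin> N \<union> ((\<Union>t\<in>J. {\<omega> \<in> space M. ennreal (r / 2) \<le> R t k \<omega>}) \<union> {\<omega> \<in> space M. ennreal \<delta>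
          \<le> D k \<omega>})"
      then have not: "\<omega> \<notin> N" "R t k \<omega> < ennreal (r / 2)" "D k \<omega> < ennreal \<delta>" using \<omega> by
          (auto simp: not_le)
      have "\<bar>simple_integral_wrt B (S k) t \<omega> - I t \<omega>\<bar> < r / 2"
        using not(2) by (simp add: R_def ennreal_less_iff)
      then have "r / 2 \<le> \<bar>simple_integral_wrt B (S k) t \<omega>\<bar>" using \<omega>(3) by linarith
      moreover have "(\<integral>\<^sup>+ s\<in>{0..T}. ennreal ((simple_value (S k) s \<omega>)\<^sup>2) \<partial>lborel) \<le> ennreal (4 * \<delta>)"
      proof -
        have "(\<integral>\<^sup>+ s\<in>{0..T}. ennreal ((simple_value (S k) s \<omega>)\<^sup>2) \<partial>lborel) \<le>
           2 * D k \<omega> + 2 * (\<integral>\<^sup>+ s\<in>{0..T}. ennreal ((H s \<omega>)\<^sup>2) \<partial>lborel)"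
          unfolding D_def
        proof (rule energy_triangle)
          show "(\<lambda>s. simple_value (S k) s \<omega> * indicator {0..T} s) \<in> borel_measurable lborel"
            by (intro borel_measurable_times simple_value_measurable) auto
          show "(\<lambda>s. H s \<omega> * indicator {0..T} s) \<in> borel_measurable lborel"
            by (rule progressive_path_measurable[OF H \<open>0 \<le> T\<close> filtration_sub[OF \<open>0 \<le> T\<close>] \<omega>(1)])
        qed
        also have "\<dots> \<le> 2 * ennreal \<delta> + 2 * ennreal \<delta>"
          using not(3) \<omega>(4) by (intro add_mono mult_left_mono) auto
        also have "\<dots> = ennreal (4 * \<delta>)"
          using \<open>0 < \<delta>\<close> by (simp flip: distrib_right add: ennreal_mult)
        finally show ?thesis .
      qed
      ultimately have "\<omega> \<in> N" using N(2) \<omega> by blast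
      with not(1) show False by simp
    qed
    then have "emeasure M ?E \<le> emeasure M (N \<union> ((\<Union>t\<in>J. {\<omega> \<in> space M. ennreal (r / 2) \<le> R t k \<omega>})
        \<union> {\<omega> \<in> space M. ennreal \<delta> \<le> D k \<omega>}))"
      using N(1) J(1) by (intro emeasure_mono sets.Un sets.finite_UN)
          (auto intro: borel_measurable_le R_meas)
    also have "\<dots> \<le> emeasure M N + (emeasure M (\<Union>t\<in>J. {\<omega> \<in> space M. ennreal (r / 2) \<le> R t k \<omega>})
        + emeasure M {\<omega> \<in> space M. ennreal \<delta> \<le> D k \<omega>})"
      using N(1) J(1) by (intro order_trans[OF emeasure_subadditive] add_left_mono emeasure_subadditive sets.Un sets.finite_UN) (auto intro: borel_measurable_le R_meas)
    also have "\<dots> \<le> e k"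
      unfolding e_def
    proof (intro add_mono order_refl)
      show "emeasure M N \<le> ennreal (16 * \<delta> / r\<^sup>2)"
        unfolding emeasure_eq_measure using N(3) by (intro ennreal_leI)
            (simp add: power_divide mult.commute)
      show "emeasure M (\<Union>t\<in>J. {\<omega> \<in> space M. ennreal (r / 2) \<le> R t k \<omega>}) \<le>
         (\<Sum>t\<in>J. emeasure M {\<omega> \<in> space M. ennreal (r / 2) \<le> R t k \<omega>})"
        using J(1) by (intro emeasure_subadditive_finite) (auto intro: borel_measurable_le R_meas)
    qed
    finally show ?thesis .
  qed
  have "e \<longlonglongrightarrow> ennreal (16 * \<delta> / r\<^sup>2) + ((\<Sum>t\<in>J. 0) + 0)"
    unfolding e_def
  proof (intro tendsto_add tendsto_const tendsto_sum)
    show "(\<lambda>k. emeasure M {\<omega> \<in> space M. ennreal (r / 2) \<le> R t k \<omega>}) \<longlonglongrightarrow> 0" if "t \<in> J" for t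
      unfolding R_def by (rule null_in_probabilityD[OF S_I[OF that]]) (use \<open>0 < r\<close> in simp)
    show "(\<lambda>k. emeasure M {\<omega> \<in> space M. ennreal \<delta> \<le> D k \<omega>}) \<longlonglongrightarrow> 0"
      unfolding D_def by (rule null_in_probabilityD[OF S_H]) (use \<open>0 < \<delta>\<close> in simp)
  qed
  then show ?thesis
    by (intro LIMSEQ_le_const[of e]) (auto simp: bound)
qed

text \<open>
  The rational times are exhausted by finite sets. Restricting to them keeps the event measurable,
  and almost surely loses nothing because \<open>I\<close> has continuous paths.
\<close>
lemma ito_maximal_inequality:
  assumes I: "has_ito_integral M F B H I" and "0 \<le> T" "0 < r" "0 < \<delta>"
  defines "E \<equiv> {\<omega> \<in> space M. (\<exists>t\<in>{0..T} \<inter> \<rat>. r < \<bar>I t \<omega>\<bar>) \<and>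
     (\<integral>\<^sup>+ s\<in>{0..T}. ennreal ((H s \<omega>)\<^sup>2) \<partial>lborel) < ennreal \<delta>}"
  shows "E \<in> events" and "prob E \<le> 16 * \<delta> / r\<^sup>2"
proof -
  let ?Q = "{0..T} \<inter> \<rat>"
  define En where "En J = {\<omega> \<in> space M. (\<exists>t\<in>J. r < \<bar>I t \<omega>\<bar>) \<and>
     (\<integral>\<^sup>+ s\<in>{0..T}. ennreal ((H s \<omega>)\<^sup>2) \<partial>lborel) < ennreal \<delta>}" for J
  have H: "progressively_measurable F H" and I_meas: "\<And>t. 0 \<le> t \<Longrightarrow> I t \<in> borel_measurable M"
    using I by (auto simp: has_ito_integral_def)
  have [measurable]: "(\<lambda>\<omega>. \<integral>\<^sup>+ s\<in>{0..T}. ennreal ((H s \<omega>)\<^sup>2) \<partial>lborel) \<in> borel_measurable M"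
    by (rule progressive_energy_measurable[OF H \<open>0 \<le> T\<close> filtration_sub[OF \<open>0 \<le> T\<close>]])
  define q where "q = from_nat_into ?Q"
  have "0 \<in> ?Q" using \<open>0 \<le> T\<close> by auto
  moreover have "countable ?Q" using countable_rat by (intro countable_Int2)
  ultimately have range_q: "range q = ?Q" unfolding q_def by (intro range_from_nat_into) auto
  then have q: "q i \<in> {0..T}" for i by blast
  have En_meas: "En (q ` {..n}) \<in> events" for n
  proof -
    have [measurable]: "I (q i) \<in> borel_measurable M" for i using q[of i] by (intro I_meas) simp
    have "En (q ` {..n}) = {\<omega> \<in> space M. (\<exists>i\<in>{..n}. r < \<bar>I (q i) \<omega>\<bar>) \<and>
     (\<integral>\<^sup>+ s\<in>{0..T}. ennreal ((H s \<omega>)\<^sup>2) \<partial>lborel) < ennreal \<delta>}" by (auto simp: En_def)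
    also have "\<dots> \<in> events" by measurable
    finally show ?thesis .
  qed
  have E_eq: "E = (\<Union>n. En (q ` {..n}))"
    unfolding E_def En_def range_q[symmetric] by auto
  show "E \<in> events" unfolding E_eq using En_meas by blast
  have "incseq (\<lambda>n. En (q ` {..n}))"
    by (rule monoI) (auto simp: En_def)
  then have "emeasure M E = (SUP n. emeasure M (En (q ` {..n})))"
    unfolding E_eq using En_meas by (intro SUP_emeasure_incseq[symmetric]) auto
  also have "\<dots> \<le> ennreal (16 * \<delta> / r\<^sup>2)"
    unfolding En_def using q
    by (intro SUP_least ito_maximal_inequality_finite[OF I \<open>0 \<le> T\<close> _ _ \<open>0 < r\<close> \<open>0 < \<delta>\<close>]) auto
  finally show "prob E \<le> 16 * \<delta> / r\<^sup>2"
    using \<open>0 < \<delta>\<close> by (simp add: emeasure_eq_measure)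
qed

text \<open>
  By the Borel--Cantelli lemma, almost surely only finitely many of the exceptional events occur; since
  the energies are eventually below \<open>\<delta> n\<close>, only the bound on \<open>I\<close> can be what holds.
\<close>
lemma ito_eventually_bounded:
  fixes T r \<delta> :: "nat \<Rightarrow> real"
  assumes I: "has_ito_integral M F B H I"
    and pos: "\<And>n. 0 < T n" "\<And>n. 0 < r n" "\<And>n. 0 < \<delta> n"
    and sum: "summable (\<lambda>n. \<delta> n / (r n)\<^sup>2)"
    and energy: "AE \<omega> in M. eventually (\<lambda>n.
       (\<integral>\<^sup>+ s\<in>{0..T n}. ennreal ((H s \<omega>)\<^sup>2) \<partial>lborel) < ennreal (\<delta> n)) sequentially"
  shows "AE \<omega> in M. eventually (\<lambda>n. \<forall>t\<in>{0..T n}. \<bar>I t \<omega>\<bar> \<le> r n) sequentially"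
proof -
  let ?E = "\<lambda>n. {\<omega> \<in> space M. (\<exists>t\<in>{0..T n} \<inter> \<rat>. r n < \<bar>I t \<omega>\<bar>) \<and>
     (\<integral>\<^sup>+ s\<in>{0..T n}. ennreal ((H s \<omega>)\<^sup>2) \<partial>lborel) < ennreal (\<delta> n)}"
  note E = ito_maximal_inequality[OF I less_imp_le[OF pos(1)] pos(2,3)]
  have "summable (\<lambda>n. prob (?E n))"
    by (rule summable_comparison_test'[OF summable_mult[OF sum, of 16], of 0]) (use E(2) in auto)
  then have "AE \<omega> in M. eventually (\<lambda>n. \<omega> \<in> space M - ?E n) sequentially"
    by (intro borel_cantelli_AE1 E(1)) (auto simp: emeasure_eq_measure)
  moreover have "AE \<omega> in M. continuous_on {0..} (\<lambda>t. I t \<omega>)"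
    using I by (simp add: has_ito_integral_def)
  ultimately show ?thesis using energy
  proof eventually_elim
    case (elim \<omega>)
    from elim(1,3) show ?case
    proof eventually_elim
      case (elim n)
      then have "\<bar>I t \<omega>\<bar> \<le> r n" if "t \<in> {0..T n} \<inter> \<rat>" for t using that by (auto simp: not_less)
      then show ?case
        using bounded_on_rationals_imp_bounded[OF \<open>continuous_on {0..} (\<lambda>t. I t \<omega>)\<close> pos(1)] by blast
    qed
  qed
qed

end

section \<open>The growth of Brownian motion\<close>

context filtered_brownian_motion
begin

text \<open>
  This makes the bounds for Ito integrals available for the Brownian motion itself.
\<close>
lemma ito_integral_one: "has_ito_integral M F B (\<lambda>_ _. 1) B"
  unfolding has_ito_integral_def
proof (intro conjI allI impI)
  show "progressively_measurable F (\<lambda>_ _. 1)" by (simp add: progressively_measurable_def)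
  show "AE \<omega> in M. (\<integral>\<^sup>+ s\<in>{0..T}. ennreal (1\<^sup>2) \<partial>lborel) < \<infinity>" if "0 \<le> T" for T :: real
    using that by simp
  show "B t \<in> borel_measurable M" if "0 \<le> t" for t using measurable_at[OF that] .
  show "AE \<omega> in M. continuous_on {0..} (\<lambda>t. B t \<omega>)"
    by (intro AE_I2 continuous_paths)
  define S :: "nat \<Rightarrow> 'a simple_process" where "S k = (1, \<lambda>i. real i * real (Suc k), \<lambda>_ _. 1)" for k
  have value_eq: "simple_value (S k) s \<omega> = indicator {0<..real (Suc k)} s" for k s \<omega>
    unfolding S_def simple_value_def prod.case One_nat_def lessThan_Suc lessThan_0 by simp
  have integral_eq: "simple_integral_wrt B (S k) t \<omega>
      = B (min t (real (Suc k))) \<omega> - B (min t 0) \<omega>" for k t \<omega>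
    by (simp add: S_def simple_integral_wrt_def)
  show "\<exists>S. (\<forall>k. is_simple_process M F (S k)) \<and>
        (\<forall>T\<ge>0. null_in_probability M
           (\<lambda>k \<omega>. \<integral>\<^sup>+ s\<in>{0..T}. ennreal ((simple_value (S k) s \<omega> - 1)\<^sup>2) \<partial>lborel)) \<and>
        (\<forall>t\<ge>0. null_in_probability M
           (\<lambda>k \<omega>. ennreal \<bar>simple_integral_wrt B (S k) t \<omega> - B t \<omega>\<bar>))"
  proof (intro exI[of _ S] conjI allI impI)
    show "is_simple_process M F (S k)" for k
      by (auto simp: S_def is_simple_process_def image_constant_conv)
    show "null_in_probability M (\<lambda>k \<omega>. \<integral>\<^sup>+ s\<in>{0..T}. ennreal ((simple_value (S k) s \<omega> - 1)\<^sup>2)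
        \<partial>lborel)"
      if "0 \<le> T" for T
      unfolding null_in_probability_def
    proof (intro conjI allI impI)
      fix \<epsilon> :: ennreal assume "0 < \<epsilon>"
      have zero: "(\<integral>\<^sup>+ s\<in>{0..T}. ennreal ((simple_value (S k) s \<omega> - 1)\<^sup>2) \<partial>lborel) = 0" if "T
          \<le> real k" for k \<omega>
      proof -
        have "AE s in lborel. s \<noteq> (0 :: real)" by (rule AE_lborel_singleton)
        then have "AE s in lborel. ennreal ((simple_value (S k) s \<omega> - 1)\<^sup>2) * indicator {0..T} s
            = 0"
          by eventually_elim (unfold value_eq, use that in \<open>auto simp: indicator_def\<close>)
        then show ?thesis by (subst nn_integral_cong_AE[where v="\<lambda>_. 0"]) auto
      qed
      have "eventually (\<lambda>k. T \<le> real k) sequentially"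
        by (rule eventually_sequentiallyI[of "nat \<lceil>T\<rceil>"]) linarith
      then show "(\<lambda>k. emeasure M {\<omega> \<in> space M. \<epsilon>
          \<le> (\<integral>\<^sup>+ s\<in>{0..T}. ennreal ((simple_value (S k) s \<omega> - 1)\<^sup>2) \<partial>lborel)}) \<longlonglongrightarrow> 0"
        by (intro tendsto_eventually, elim eventually_mono) (use \<open>0 < \<epsilon>\<close>
            in \<open>simp add: zero zero_less_iff_neq_zero\<close>)
    qed (simp add: value_eq)
    show "null_in_probability M (\<lambda>k \<omega>. ennreal \<bar>simple_integral_wrt B (S k) t \<omega> - B t \<omega>\<bar>)"
      if t: "0 \<le> t" for t
      unfolding null_in_probability_def
    proof (intro conjI allI impI)
      have [measurable]: "B s \<in> borel_measurable M" if "0 \<le> s" for s using measurable_at[OF that] .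
      show "(\<lambda>\<omega>. ennreal \<bar>simple_integral_wrt B (S k) t \<omega> - B t \<omega>\<bar>) \<in> borel_measurable M" for k
        unfolding integral_eq using t by simp
      fix \<epsilon> :: ennreal assume "0 < \<epsilon>"
      have eq: "simple_integral_wrt B (S k) t \<omega> - B t \<omega> = - B 0 \<omega>" if "t \<le> real k" for k \<omega>
        unfolding integral_eq using t that by (simp add: min_def)
      have "emeasure M {\<omega> \<in> space M. \<epsilon> \<le> ennreal \<bar>B 0 \<omega>\<bar>} = 0"
      proof (rule emeasure_eq_0_AE)
        show "AE \<omega> in M. \<not> \<epsilon> \<le> ennreal \<bar>B 0 \<omega>\<bar>"
          using starts_at_0 by eventually_elim (use \<open>0 < \<epsilon>\<close> in simp)
      qed
      moreover have "eventually (\<lambda>k. t \<le> real k) sequentially"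
        by (rule eventually_sequentiallyI[of "nat \<lceil>t\<rceil>"]) linarith
      ultimately show "(\<lambda>k. emeasure M {\<omega> \<in> space M. \<epsilon>
          \<le> ennreal \<bar>simple_integral_wrt B (S k) t \<omega> - B t \<omega>\<bar>}) \<longlonglongrightarrow> 0"
        by (intro tendsto_eventually, elim eventually_mono) (simp add: eq)
    qed
  qed
qed

end

lemma dyadic_interval:
  fixes t :: real
  assumes "2 ^ K \<le> t"
  obtains k where "K \<le> k" "2 ^ k \<le> t" "t \<le> 2 ^ Suc k"
proof -
  define k where "k = (LEAST k. t \<le> 2 ^ Suc k)"
  obtain n where "t < 2 ^ n" using real_arch_pow[of 2 t] by auto
  also have "(2 :: real) ^ n \<le> 2 ^ Suc n" by (rule power_increasing) auto
  finally have "t \<le> 2 ^ Suc n" by simp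
  then have k: "t \<le> 2 ^ Suc k" unfolding k_def by (rule LeastI)
  have lower: "2 ^ k \<le> t \<and> K \<le> k" if "K \<le> k"
  proof (cases "k = K")
    case False
    then obtain j where j: "k = Suc j" using \<open>K \<le> k\<close> by (cases k) auto
    then have "\<not> t \<le> 2 ^ Suc j" using not_less_Least[of j "\<lambda>k. t \<le> 2 ^ Suc k"] by (simp add: k_def)
    then show ?thesis using that j by simp
  qed (use assms in simp)
  show ?thesis
  proof (cases "K \<le> k")
    case True
    then show ?thesis using k lower by (intro that[of k]) auto
  next
    case False
    then have "(2 :: real) ^ Suc k \<le> 2 ^ K" by (intro power_increasing) auto
    then have "t \<le> 2 ^ K" using k by linarith
    moreover have "(2 :: real) ^ K \<le> 2 ^ Suc K" by (rule power_increasing) auto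
    ultimately show ?thesis using assms by (intro that[of K]) linarith+
  qed
qed

context filtered_brownian_motion
begin

text \<open>
  At dyadic times the exceptional probabilities are of order \<open>2 ^ k / (c * 2 ^ k)\<^sup>2\<close>, hence summable,
  and a bound up to time \<open>2 ^ Suc k\<close> by \<open>c * 2 ^ k\<close> is a linear bound on the last dyadic interval.
\<close>
lemma eventually_le_linear:
  assumes "0 < c"
  shows "AE \<omega> in M. eventually (\<lambda>t. \<bar>B t \<omega>\<bar> \<le> c * t) at_top"
proof -
  have "summable (\<lambda>k. 4 / c\<^sup>2 * (1 / 2 :: real) ^ k)"
    by (intro summable_mult summable_geometric) simp
  moreover have "2 ^ (k + 2) / (c * 2 ^ k)\<^sup>2 = 4 / c\<^sup>2 * (1 / 2 :: real) ^ k" for k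
    using \<open>0 < c\<close> by (simp add: power_mult_distrib field_simps power2_eq_square power_add)
  ultimately have sum: "summable (\<lambda>k. 2 ^ (k + 2) / (c * 2 ^ k)\<^sup>2)" by simp
  have "AE \<omega> in M. eventually (\<lambda>k. \<forall>t\<in>{0..2 ^ Suc k}. \<bar>B t \<omega>\<bar> \<le> c * 2 ^ k) sequentially"
  proof (rule ito_eventually_bounded[OF ito_integral_one _ _ _ sum])
    show "AE \<omega> in M. eventually (\<lambda>n. (\<integral>\<^sup>+ s\<in>{0..(2 :: real) ^ Suc n}. ennreal (1\<^sup>2)
        \<partial>lborel) < ennreal (2 ^ (n + 2))) sequentially"
    proof (intro AE_I2 always_eventually allI)
      fix n
      have "(\<integral>\<^sup>+ s\<in>{0..(2 :: real) ^ Suc n}. ennreal (1\<^sup>2) \<partial>lborel) = ennreal (2 ^ Suc n)" by simp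
      also have "\<dots> < ennreal (2 ^ (n + 2))" by (rule ennreal_lessI) auto
      finally show "(\<integral>\<^sup>+ s\<in>{0..(2 :: real) ^ Suc n}. ennreal (1\<^sup>2) \<partial>lborel) < ennreal (2 ^ (n
          + 2))" .
    qed
  qed (use \<open>0 < c\<close> in auto)
  then show ?thesis
  proof eventually_elim
    case (elim \<omega>)
    then obtain K where K: "\<And>k t. K \<le> k \<Longrightarrow> t \<in> {0..2 ^ Suc k} \<Longrightarrow> \<bar>B t \<omega>\<bar> \<le> c * 2 ^ k"
      unfolding eventually_sequentially by blast
    show ?case
    proof (rule eventually_at_top_linorderI[of "2 ^ K"])
      fix t :: real assume "2 ^ K \<le> t"
      then obtain k where k: "K \<le> k" "2 ^ k \<le> t" "t \<le> 2 ^ Suc k" by (rule dyadic_interval)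
      moreover have "0 \<le> t" using \<open>2 ^ k \<le> t\<close> by (rule order_trans[rotated]) simp
      ultimately have "\<bar>B t \<omega>\<bar> \<le> c * 2 ^ k" by (intro K) auto
      also have "\<dots> \<le> c * t" using \<open>0 < c\<close> k by simp
      finally show "\<bar>B t \<omega>\<bar> \<le> c * t" .
    qed
  qed
qed

lemma AE_all_eventually_le_linear:
  "AE \<omega> in M. \<forall>\<epsilon>>0. eventually (\<lambda>t. \<bar>B t \<omega>\<bar> \<le> \<epsilon> * t) at_top"
proof -
  have "AE \<omega> in M. \<forall>m. eventually (\<lambda>t. \<bar>B t \<omega>\<bar> \<le> inverse (real (Suc m)) * t) at_top"
    unfolding AE_all_countable by (intro allI eventually_le_linear) simp
  then show ?thesis
  proof eventually_elim
    case (elim \<omega>)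
    show ?case
    proof (intro allI impI)
      fix \<epsilon> :: real assume "0 < \<epsilon>"
      then obtain m where m: "inverse (real (Suc m)) < \<epsilon>" using reals_Archimedean by blast
      show "eventually (\<lambda>t. \<bar>B t \<omega>\<bar> \<le> \<epsilon> * t) at_top"
        using elim[rule_format, of m] eventually_ge_at_top[of 0]
      proof eventually_elim
        case (elim t)
        then show ?case using mult_right_mono[OF less_imp_le[OF m], of t] by linarith
      qed
    qed
  qed
qed

end

section \<open>Exponential growth of Ito integrals\<close>

text \<open>
  The compact initial piece, on which the exponential bound may fail, contributes a constant factor.
  This factor and the length of the interval are absorbed by the extra \<open>2 * e\<close> in the exponent.
\<close>
lemma energy_eventually_less_exp:
  fixes h :: "real \<Rightarrow> real"
  assumes h: "continuous_on {0..} h" and bound: "eventually (\<lambda>t. \<bar>h t\<bar> \<le> exp ((b + e) * t)) at_top"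
    and "0 \<le> b" "0 < e"
  shows "eventually (\<lambda>n. (\<integral>\<^sup>+ s\<in>{0..real (Suc n)}. ennreal ((h s)\<^sup>2) \<partial>lborel) <
     ennreal (exp (2 * (b + 2 * e) * real (Suc n)))) sequentially"
proof -
  obtain T0 where T0: "\<And>t. T0 \<le> t \<Longrightarrow> \<bar>h t\<bar> \<le> exp ((b + e) * t)"
    using bound unfolding eventually_at_top_linorder by blast
  have "compact (h ` {0..T0})"
    by (intro compact_continuous_image continuous_on_subset[OF h]) auto
  then obtain C where C: "\<And>t. t \<in> {0..T0} \<Longrightarrow> \<bar>h t\<bar> \<le> C"
    using compact_imp_bounded by (fastforce simp: bounded_iff)
  define A where "A = C\<^sup>2 + 1"
  define N where "N = nat \<lceil>A / (2 * e\<^sup>2)\<rceil>"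
  show ?thesis
  proof (rule eventually_sequentiallyI[of N])
    fix n assume "N \<le> n"
    define T where "T = real (Suc n)"
    have T: "0 < T" by (simp add: T_def)
    let ?E = "exp (2 * (b + e) * T)"
    have one_le: "1 \<le> ?E" using \<open>0 \<le> b\<close> \<open>0 < e\<close> T by simp
    have pt: "(h s)\<^sup>2 \<le> A * ?E" if s: "s \<in> {0..T}" for s
    proof (cases "T0 \<le> s")
      case True
      have "\<bar>h s\<bar> \<le> exp ((b + e) * s)" by (rule T0[OF True])
      also have "\<dots> \<le> exp ((b + e) * T)" using s \<open>0 \<le> b\<close> \<open>0 < e\<close> by simp
      finally have "\<bar>h s\<bar>\<^sup>2 \<le> (exp ((b + e) * T))\<^sup>2" by (intro power_mono) auto
      also have "\<dots> = ?E" by (simp add: power2_eq_square exp_add[symmetric] algebra_simps)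
      also have "\<dots> \<le> A * ?E" by (simp add: A_def)
      finally show ?thesis by simp
    next
      case False
      then have "\<bar>h s\<bar> \<le> C" using s by (intro C) auto
      then have "\<bar>h s\<bar>\<^sup>2 \<le> C\<^sup>2" by (intro power_mono) auto
      also have "\<dots> \<le> A * 1" by (simp add: A_def)
      also have "\<dots> \<le> A * ?E" using one_le by (intro mult_left_mono) (auto simp: A_def)
      finally show ?thesis by simp
    qed
    have "(\<integral>\<^sup>+ s\<in>{0..T}. ennreal ((h s)\<^sup>2) \<partial>lborel) \<le> (\<integral>\<^sup>+ s\<in>{0..T}. ennreal (A * ?E) \<partial>lborel)"
      using pt by (intro nn_integral_mono) (auto simp: indicator_def intro: ennreal_leI)
    also have "\<dots> = ennreal (A * ?E) * ennreal T"
      using T by (simp add: nn_integral_cmult_indicator)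
    also have "\<dots> = ennreal (A * ?E * T)" using T by (simp add: ennreal_mult'')
    also have "\<dots> < ennreal (exp (2 * (b + 2 * e) * T))"
    proof (rule ennreal_lessI)
      have "A / (2 * e\<^sup>2) \<le> T" using \<open>N \<le> n\<close> unfolding N_def T_def by linarith
      then have "A \<le> 2 * e\<^sup>2 * T" using \<open>0 < e\<close> by (simp add: field_simps)
      then have "A * T \<le> 2 * e\<^sup>2 * T * T" using T by (intro mult_right_mono) auto
      also have "\<dots> = (2 * e * T)\<^sup>2 / 2" by (simp add: power2_eq_square)
      also have "\<dots> < exp (2 * e * T)"
        using exp_lower_Taylor_quadratic[of "2 * e * T"] T \<open>0 < e\<close> by (smt (verit) mult_pos_pos)
      finally have "A * T * ?E < exp (2 * e * T) * ?E" by simp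
      also have "\<dots> = exp (2 * (b + 2 * e) * T)" by (simp add: exp_add[symmetric] algebra_simps)
      finally show "A * ?E * T < exp (2 * (b + 2 * e) * T)" by (simp add: mult_ac)
    qed simp
    finally show "(\<integral>\<^sup>+ s\<in>{0..real (Suc n)}. ennreal ((h s)\<^sup>2) \<partial>lborel) <
     ennreal (exp (2 * (b + 2 * e) * real (Suc n)))" by (simp add: T_def)
  qed
qed

context filtered_brownian_motion
begin

text \<open>
  Up to time \<open>n + 1\<close> the energy is eventually below \<open>exp (2 * (b + 2 * e) * (n + 1))\<close>; against the
  bound \<open>exp ((b + 3 * e) * (n + 1))\<close> for the integral this leaves the summable ratio
  \<open>exp (- 2 * e * (n + 1))\<close>. A further \<open>e\<close> pays for passing from \<open>n + 1\<close> to arbitrary times, which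
  is where \<open>0 \<le> b\<close> enters: an integral of a decaying integrand need not decay.
\<close>
lemma ito_exponential_growth:
  assumes I: "has_ito_integral M F B H I" and "0 \<le> b"
    and H_cont: "\<And>\<omega>. \<omega> \<in> space M \<Longrightarrow> continuous_on {0..} (\<lambda>t. H t \<omega>)"
    and H_bound: "AE \<omega> in M. \<forall>\<epsilon>>0. eventually (\<lambda>t. \<bar>H t \<omega>\<bar> \<le> exp ((b + \<epsilon>) * t)) at_top"
  shows "AE \<omega> in M. \<forall>\<epsilon>>0. eventually (\<lambda>t. \<bar>I t \<omega>\<bar> \<le> exp ((b + \<epsilon>) * t)) at_top"
proof -
  have step: "AE \<omega> in M. eventually (\<lambda>n. \<forall>t\<in>{0..real (Suc n)}. \<bar>I t \<omega>\<bar> \<le> exp ((b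
      + 3 * e) * real (Suc n))) sequentially"
    if "0 < e" for e
  proof (rule ito_eventually_bounded[OF I])
    have "summable (\<lambda>n. exp (- 2 * e) * exp (- 2 * e) ^ n)"
      using \<open>0 < e\<close> by (intro summable_mult summable_geometric) simp
    moreover have "exp (2 * (b + 2 * e) * real (Suc n)) / (exp ((b + 3 * e) * real (Suc n)))\<^sup>2 =
       exp (- 2 * e) * exp (- 2 * e) ^ n" for n
      by (simp add: power2_eq_square exp_add[symmetric] exp_diff[symmetric] exp_of_nat_mult[symmetric] algebra_simps)
    ultimately show "summable (\<lambda>n. exp (2 * (b + 2 * e) * real (Suc n)) / (exp ((b
        + 3 * e) * real (Suc n)))\<^sup>2)"
      by simp
    show "AE \<omega> in M. eventually (\<lambda>n. (\<integral>\<^sup>+ s\<in>{0..real (Suc n)}. ennreal ((H s \<omega>)\<^sup>2) \<partial>lborel) <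
       ennreal (exp (2 * (b + 2 * e) * real (Suc n)))) sequentially"
      using H_bound AE_space
      by eventually_elim (intro energy_eventually_less_exp, use H_cont \<open>0 \<le> b\<close> \<open>0 < e\<close> in auto)
  qed auto
  have "AE \<omega> in M. \<forall>m. eventually (\<lambda>n. \<forall>t\<in>{0..real (Suc n)}.
      \<bar>I t \<omega>\<bar> \<le> exp ((b + 3 * inverse (real (Suc m))) * real (Suc n))) sequentially"
    unfolding AE_all_countable by (intro allI step) simp
  then show ?thesis
  proof eventually_elim
    case (elim \<omega>)
    show ?case
    proof (intro allI impI)
      fix \<epsilon> :: real assume "0 < \<epsilon>"
      then obtain m where m: "inverse (real (Suc m)) < \<epsilon> / 4" using reals_Archimedean[of "\<epsilon> / 4"]
          by auto
      define e where "e = inverse (real (Suc m))"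
      have e: "0 < e" "4 * e < \<epsilon>" using m by (auto simp: e_def)
      obtain N where N: "\<And>n t. N \<le> n \<Longrightarrow> t \<in> {0..real (Suc n)} \<Longrightarrow> \<bar>I t \<omega>\<bar> \<le> exp ((b
          + 3 * e) * real (Suc n))"
        using elim[rule_format, of m] unfolding eventually_sequentially e_def by blast
      show "eventually (\<lambda>t. \<bar>I t \<omega>\<bar> \<le> exp ((b + \<epsilon>) * t)) at_top"
      proof (rule eventually_at_top_linorderI[of "max (real N) ((b + 3 * e) / e)"])
        fix t assume "max (real N) ((b + 3 * e) / e) \<le> t"
        then have t: "real N \<le> t" "(b + 3 * e) / e \<le> t" by auto
        define n where "n = nat \<lfloor>t\<rfloor>"
        have n: "real n \<le> t" "t \<le> real (Suc n)" "N \<le> n" "0 \<le> t"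
          using t(1) unfolding n_def by linarith+
        have "\<bar>I t \<omega>\<bar> \<le> exp ((b + 3 * e) * real (Suc n))" using n by (intro N) auto
        also have "(b + 3 * e) * real (Suc n) \<le> (b + 3 * e) * (t + 1)"
          using n(1) \<open>0 \<le> b\<close> e by (intro mult_left_mono) auto
        also have "\<dots> = (b + 3 * e) * t + (b + 3 * e)" by (simp add: algebra_simps)
        also have "\<dots> \<le> (b + 3 * e) * t + e * t" using t(2) e(1) by (simp add: field_simps)
        also have "\<dots> = (b + 4 * e) * t" by (simp add: algebra_simps)
        also have "\<dots> \<le> (b + \<epsilon>) * t" using n(4) e(2) by (intro mult_right_mono) auto
        finally show "\<bar>I t \<omega>\<bar> \<le> exp ((b + \<epsilon>) * t)" by simp
      qed
    qed
  qed
qed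

end

section \<open>The rate of escape\<close>

theorem corollary3p10:
  fixes M :: "'a measure" and p q a :: real
    and W W1 W2 X Y Z :: "real \<Rightarrow> 'a \<Rightarrow> real"
  assumes "0 < p" and "0 < q"
    and "brownian_motion M W" and "brownian_motion M W1" and "brownian_motion M W2"
    and "prob_space.indep_processes M [W, W1, W2]"
    and "\<And>t \<omega>. 0 \<le> t \<Longrightarrow> \<omega> \<in> space M \<Longrightarrow> Z t \<omega> = a * t + W t \<omega>"
    and "has_ito_integral M (natural_filtration M [W, W1, W2]) W1 (\<lambda>s \<omega>. exp (p * Z s \<omega>)) X"
    and "has_ito_integral M (natural_filtration M [W, W1, W2]) W2 (\<lambda>s \<omega>. exp (- q * Z s \<omega>)) Y"
  shows "AE \<omega> in M.
    ((\<lambda>t. sol_dist p q (X t \<omega>, Y t \<omega>, Z t \<omega>) (0, 0, 0) / t) \<longlongrightarrow> \<bar>a\<bar>) at_top"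
proof -
  let ?F = "natural_filtration M [W, W1, W2]"
  interpret W: brownian_motion M W by fact
  have bm: "brownian_motion M ([W, W1, W2] ! i)" if "i < length [W, W1, W2]" for i
    using that assms(3-5) by (auto simp: less_Suc_eq nth_Cons')
  note filtered = W.filtered_brownian_motion_natural_filtration[OF assms(6) bm]
  interpret FW: filtered_brownian_motion M W ?F using filtered[of 0] by simp
  interpret F1: filtered_brownian_motion M W1 ?F using filtered[of 1] by simp
  interpret F2: filtered_brownian_motion M W2 ?F using filtered[of 2] by simp
  have Z_cont: "continuous_on {0..} (\<lambda>t. Z t \<omega>)" if "\<omega> \<in> space M" for \<omega>
    using W.continuous_paths[OF that] assms(7)[OF _ that]
    by (subst continuous_on_cong[OF refl, of _ _ "\<lambda>t. a * t + W t \<omega>"])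
        (auto intro!: continuous_intros)
  have Z_drift: "AE \<omega> in M. \<forall>\<epsilon>>0. eventually (\<lambda>t. \<bar>Z t \<omega> - a * t\<bar> \<le> \<epsilon> * t) at_top"
    using FW.AE_all_eventually_le_linear AE_space
  proof eventually_elim
    case (elim \<omega>)
    show ?case
    proof (intro allI impI)
      fix \<epsilon> :: real assume "0 < \<epsilon>"
      then have "eventually (\<lambda>t. \<bar>W t \<omega>\<bar> \<le> \<epsilon> * t) at_top" using elim by blast
      then show "eventually (\<lambda>t. \<bar>Z t \<omega> - a * t\<bar> \<le> \<epsilon> * t) at_top"
        using eventually_ge_at_top[of 0] by eventually_elim (use elim assms(7) in simp)
    qed
  qed
  have exp_bound: "AE \<omega> in M. \<forall>\<epsilon>>0. eventually (\<lambda>t. \<bar>exp (c * Z t \<omega>)\<bar> \<le> exp ((max (c * a) 0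
      + \<epsilon>) * t)) at_top"
    if "c \<noteq> 0" for c
    using Z_drift
  proof eventually_elim
    case (elim \<omega>)
    show ?case
    proof (intro allI impI)
      fix \<epsilon> :: real assume "0 < \<epsilon>"
      then have "eventually (\<lambda>t. \<bar>Z t \<omega> - a * t\<bar> \<le> \<epsilon> / \<bar>c\<bar> * t) at_top"
        using that by (intro elim[rule_format]) simp
      then show "eventually (\<lambda>t. \<bar>exp (c * Z t \<omega>)\<bar> \<le> exp ((max (c * a) 0 + \<epsilon>) * t)) at_top"
        using eventually_ge_at_top[of 0]
      proof eventually_elim
        case (elim t)
        have "c * Z t \<omega> - c * a * t \<le> \<bar>c\<bar> * \<bar>Z t \<omega> - a * t\<bar>"
          unfolding abs_mult[symmetric] by (simp add: algebra_simps)
        also have "\<dots> \<le> \<bar>c\<bar> * (\<epsilon> / \<bar>c\<bar> * t)" using elim by (intro mult_left_mono) auto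
        also have "\<dots> = \<epsilon> * t" using that by simp
        finally have "c * Z t \<omega> \<le> c * a * t + \<epsilon> * t" by simp
        also have "\<dots> \<le> (max (c * a) 0 + \<epsilon>) * t"
          unfolding distrib_right using elim by (intro add_right_mono mult_right_mono) auto
        finally show ?case by simp
      qed
    qed
  qed
  have X_growth: "AE \<omega> in M. \<forall>\<epsilon>>0. eventually (\<lambda>t. \<bar>X t \<omega>\<bar> \<le> exp ((max (p * a) 0 + \<epsilon>) * t)) at_top"
    using exp_bound[of p] \<open>0 < p\<close>
    by (intro F1.ito_exponential_growth[OF assms(8)]) (auto intro!: continuous_intros Z_cont)
  have Y_growth: "AE \<omega> in M. \<forall>\<epsilon>>0. eventually (\<lambda>t. \<bar>Y t \<omega>\<bar> \<le> exp ((max (- q * a) 0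
      + \<epsilon>) * t)) at_top"
    using exp_bound[of "- q"] \<open>0 < q\<close>
    by (intro F2.ito_exponential_growth[OF assms(9)]) (auto intro!: continuous_intros Z_cont)
  have max_scale: "max (c * x) 0 = c * max x 0" if "0 < c" for c x :: real
    using that by (auto simp: max_def mult_le_0_iff zero_le_mult_iff)
  show ?thesis
    using Z_drift X_growth Y_growth
  proof eventually_elim
    case (elim \<omega>)
    show ?case
    proof (rule tendstoI)
      fix e :: real assume "0 < e"
      \<comment> \<open>The upper bound exceeds \<open>\<bar>a\<bar>\<close> by five errors \<open>\<epsilon>\<close> and by \<open>2 / t \<le> \<epsilon>\<close>, hence by less than \<open>e\<close>.\<close>
      define \<epsilon> where "\<epsilon> = e / 7"
      have "0 < \<epsilon>" using \<open>0 < e\<close> by (simp add: \<epsilon>_def)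
      have "eventually (\<lambda>t. \<bar>Z t \<omega> - a * t\<bar> \<le> \<epsilon> * t) at_top"
        "eventually (\<lambda>t. \<bar>X t \<omega>\<bar> \<le> exp ((max (p * a) 0 + p * \<epsilon>) * t)) at_top"
        "eventually (\<lambda>t. \<bar>Y t \<omega>\<bar> \<le> exp ((max (- q * a) 0 + q * \<epsilon>) * t)) at_top"
        using elim \<open>0 < \<epsilon>\<close> \<open>0 < p\<close> \<open>0 < q\<close> by auto
      then show "eventually (\<lambda>t. dist (sol_dist p q (X t \<omega>, Y t \<omega>, Z t \<omega>) (0, 0, 0) / t) \<bar>a\<bar> < e) at_top"
        using eventually_ge_at_top[of "2 / \<epsilon>"] eventually_gt_at_top[of 0]
      proof eventually_elim
        case (elim t)
        let ?d = "sol_dist p q (X t \<omega>, Y t \<omega>, Z t \<omega>) (0, 0, 0)"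
        have t: "0 < t" by fact
        have "?d \<le> \<bar>a\<bar> * t + 5 * \<epsilon> * t + 2"
        proof (rule sol_dist_le_of_growth_bounds[OF \<open>0 < \<epsilon>\<close> less_imp_le[OF t]])
          show "\<bar>Y t \<omega>\<bar> \<le> exp ((q * max (- a) 0 + q * \<epsilon>) * t)"
            using elim(3) max_scale[OF \<open>0 < q\<close>, of "- a"] by simp
        qed (use elim max_scale[OF \<open>0 < p\<close>] in auto)
        moreover have "2 \<le> \<epsilon> * t" using elim(4) \<open>0 < \<epsilon>\<close> by (simp add: field_simps)
        ultimately have upper: "?d \<le> (\<bar>a\<bar> + 6 * \<epsilon>) * t" by (simp add: algebra_simps)
        have "\<bar>a\<bar> * t \<le> \<bar>Z t \<omega>\<bar> + \<epsilon> * t"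
          using elim(1) t abs_mult[of a t] by linarith
        also have "\<bar>Z t \<omega>\<bar> \<le> ?d" by (rule height_le_sol_dist_origin)
        finally have lower: "(\<bar>a\<bar> - \<epsilon>) * t \<le> ?d" by (simp add: algebra_simps)
        have "?d / t \<le> \<bar>a\<bar> + 6 * \<epsilon>" "\<bar>a\<bar> - \<epsilon> \<le> ?d / t"
          using upper lower t by (simp_all add: pos_divide_le_eq pos_le_divide_eq)
        then show ?case using \<open>0 < e\<close> by (simp add: dist_real_def \<epsilon>_def abs_if)
      qed
    qed
  qed
qed

end
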